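(* Let $q_+,q_->1$ be integers with $q_+\ne q_-$, let $T=T_{q_+,q_-}$ be the semi-homogeneous tree, $G=\mathrm{Aut}(T)$ and $v_0\in V_+$. The following properties of a function $\phi\not\equiv 0$ on $V_+$ are equivalent: (i) $\phi$ is a spherical function on $V_+$; (ii) for all $v,w\in V_+$, $\mathcal{E}(\tau[v]\,\phi)(w)=\phi(v)\,\phi(w)$; (iii) the functional $L_\phi(f)=\langle f,\phi\rangle$ is multiplicative on the convolution algebra $\ell^1_\#(V_+)$, i.e. $L_\phi(f*g)=L_\phi(f)L_\phi(g)$ for all $f,g\in\ell^1_\#(V_+)$.
   Context: Tree: $T_{q_+,q_-}$ is the infinite tree whose vertex set $V$ is partitioned as $V_+\sqcup V_-$, where every edge joins a vertex of $V_+$ to a vertex of $V_-$, each vertex of $V_+$ has $q_++1$ neighbors and each vertex of $V_-$ has $q_-+1$ neighbors. $\mathrm{dist}$ is the graph distance and $|v|=\mathrm{dist}(v,v_0)$. A function is radial (around $v_0$) if it depends only on $|v|$. $G$ is the group of graph automorphisms of $T$; it acts transitively on $V_+$. Laplace operator: $\mu_1f(v)=\frac{1}{q_v+1}\sum_{w\sim v}f(w)$, with $q_v=q_\pm$ for $v\in V_\pm$. For $\gamma\in\mathbb{C}$, $\phi(\,\cdot\,,v_0\,|\,\gamma)$ is the unique radial function on $V$ with $\mu_1\phi=\gamma\phi$ and value $1$ at $v_0$. A spherical function on $V_+$ is the restriction to $V_+$ of $\phi(\,\cdot\,,v_0\,|\,\gamma)$ for some $\gamma\in\mathbb{C}$.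 $\ell^1_\#(V_+)$ is the space of radial functions in $\ell^1(V_+)$, with the convolution $f*g(v)=\sum_{w\in V_+}f(\mathrm{dist}(v,w))\,g(w)$, where for radial $f$ we write $f(n)$ for the value of $f$ at vertices of length $n$. The pairing is $\langle f,\phi\rangle=\sum_{v\in V_+}f(v)\phi(v)$. For $v\in V_+$, $\tau[v]\in G$ is a chosen automorphism with $\tau[v]v_0=v$ (determined only up to its coset modulo the stabilizer of $v_0$), and $(\tau g)(u)=g(\tau^{-1}u)$ for $\tau\in G$ and $g$ a function on $V_+$. The radialization operator is $\mathcal{E}g(w)=\frac{1}{\#C(|w|)}\sum_{u\in C(|w|)}g(u)$, where $C(n)=\{u\in V:|u|=n\}$.
   Formalization: The equivalence with (iii) is stated for radial φ only (it fails otherwise: L_φ sees only the radialization of φ), and in (iii) L_φ is taken on those f in ℓ¹_# with ⟨f,φ⟩ absolutely convergent, a set required to be closed under convolution; for bounded φ this is all of ℓ¹_#. *)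

theory Defs
  imports "HOL-Analysis.Elementary_Normed_Spaces" "HOL-Analysis.Infinite_Sum"
begin

text \<open>
  The vertex set of the tree is the whole type \<open>'v\<close>; \<open>adj\<close> is its adjacency relation.
  Functions on \<open>V\<^sub>+\<close> are represented by functions on \<open>'v\<close> of which only the
  values on \<open>Vp\<close> are ever used.
\<close>

definition is_tree :: "('v \<Rightarrow> 'v \<Rightarrow> bool) \<Rightarrow> bool" where
  "is_tree adj \<longleftrightarrow>
     (\<forall>u v. adj u v \<longrightarrow> adj v u) \<and>
     (\<forall>v. \<not> adj v v) \<and>
     (\<forall>u v. adj\<^sup>*\<^sup>* u v) \<and>
     (\<nexists>xs. 3 \<le> length xs \<and> distinct xs \<and> successively adj xs \<and> adj (last xs) (hd xs))"

definition semihomogeneous_tree ::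
  "('v \<Rightarrow> 'v \<Rightarrow> bool) \<Rightarrow> 'v set \<Rightarrow> 'v set \<Rightarrow> nat \<Rightarrow> nat \<Rightarrow> bool" where
  "semihomogeneous_tree adj Vp Vm qp qm \<longleftrightarrow>
     is_tree adj \<and>
     Vp \<union> Vm = UNIV \<and> Vp \<inter> Vm = {} \<and>
     (\<forall>u v. adj u v \<longrightarrow> (u \<in> Vp \<and> v \<in> Vm) \<or> (u \<in> Vm \<and> v \<in> Vp)) \<and>
     (\<forall>v\<in>Vp. card {w. adj v w} = qp + 1) \<and>
     (\<forall>v\<in>Vm. card {w. adj v w} = qm + 1)"

definition gdist :: "('v \<Rightarrow> 'v \<Rightarrow> bool) \<Rightarrow> 'v \<Rightarrow> 'v \<Rightarrow> nat" where
  "gdist adj u v = (LEAST n. (adj ^^ n) u v)"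

definition graph_aut :: "('v \<Rightarrow> 'v \<Rightarrow> bool) \<Rightarrow> ('v \<Rightarrow> 'v) set" where
  "graph_aut adj = {g. bij g \<and> (\<forall>u v. adj (g u) (g v) \<longleftrightarrow> adj u v)}"

definition radial_on :: "('v \<Rightarrow> 'v \<Rightarrow> bool) \<Rightarrow> 'v \<Rightarrow> 'v set \<Rightarrow> ('v \<Rightarrow> complex) \<Rightarrow> bool" where
  "radial_on adj v0 S f \<longleftrightarrow>
     (\<forall>u\<in>S. \<forall>v\<in>S. gdist adj u v0 = gdist adj v v0 \<longrightarrow> f u = f v)"

definition laplace ::
  "('v \<Rightarrow> 'v \<Rightarrow> bool) \<Rightarrow> 'v set \<Rightarrow> nat \<Rightarrow> nat \<Rightarrow> ('v \<Rightarrow> complex) \<Rightarrow> 'v \<Rightarrow> complex" where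
  "laplace adj Vp qp qm f v =
     (\<Sum>w | adj v w. f w) / of_nat ((if v \<in> Vp then qp else qm) + 1)"

definition spherical_phi ::
  "('v \<Rightarrow> 'v \<Rightarrow> bool) \<Rightarrow> 'v set \<Rightarrow> nat \<Rightarrow> nat \<Rightarrow> 'v \<Rightarrow> complex \<Rightarrow> 'v \<Rightarrow> complex" where
  "spherical_phi adj Vp qp qm v0 \<gamma> =
     (THE \<phi>. radial_on adj v0 UNIV \<phi> \<and>
             (\<forall>v. laplace adj Vp qp qm \<phi> v = \<gamma> * \<phi> v) \<and> \<phi> v0 = 1)"

definition spherical_function ::
  "('v \<Rightarrow> 'v \<Rightarrow> bool) \<Rightarrow> 'v set \<Rightarrow> nat \<Rightarrow> nat \<Rightarrow> 'v \<Rightarrow> ('v \<Rightarrow> complex) \<Rightarrow> bool" where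
  "spherical_function adj Vp qp qm v0 \<phi> \<longleftrightarrow>
     (\<exists>\<gamma>. \<forall>v\<in>Vp. \<phi> v = spherical_phi adj Vp qp qm v0 \<gamma> v)"

definition translate :: "('v \<Rightarrow> 'v) \<Rightarrow> ('v \<Rightarrow> complex) \<Rightarrow> 'v \<Rightarrow> complex" where
  "translate t g u = g (inv t u)"

definition circle :: "('v \<Rightarrow> 'v \<Rightarrow> bool) \<Rightarrow> 'v \<Rightarrow> nat \<Rightarrow> 'v set" where
  "circle adj v0 n = {u. gdist adj u v0 = n}"

definition radialize ::
  "('v \<Rightarrow> 'v \<Rightarrow> bool) \<Rightarrow> 'v \<Rightarrow> ('v \<Rightarrow> complex) \<Rightarrow> 'v \<Rightarrow> complex" where
  "radialize adj v0 g w =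
     (\<Sum>u\<in>circle adj v0 (gdist adj w v0). g u) / of_nat (card (circle adj v0 (gdist adj w v0)))"

definition ell1_radial :: "('v \<Rightarrow> 'v \<Rightarrow> bool) \<Rightarrow> 'v set \<Rightarrow> 'v \<Rightarrow> ('v \<Rightarrow> complex) set" where
  "ell1_radial adj Vp v0 = {f. radial_on adj v0 Vp f \<and> f abs_summable_on Vp}"

text \<open>The value \<open>f(n)\<close>; on \<open>V\<^sub>+\<close> only even \<open>n\<close> occur as lengths.\<close>

definition radial_value ::
  "('v \<Rightarrow> 'v \<Rightarrow> bool) \<Rightarrow> 'v set \<Rightarrow> 'v \<Rightarrow> ('v \<Rightarrow> complex) \<Rightarrow> nat \<Rightarrow> complex" where
  "radial_value adj Vp v0 f n = (THE c. \<forall>u\<in>Vp. gdist adj u v0 = n \<longrightarrow> f u = c)"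

definition convolution ::
  "('v \<Rightarrow> 'v \<Rightarrow> bool) \<Rightarrow> 'v set \<Rightarrow> 'v \<Rightarrow> ('v \<Rightarrow> complex) \<Rightarrow> ('v \<Rightarrow> complex) \<Rightarrow> 'v \<Rightarrow> complex" where
  "convolution adj Vp v0 f g v =
     (\<Sum>\<^sub>\<infinity>w\<in>Vp. radial_value adj Vp v0 f (gdist adj v w) * g w)"

definition pairing :: "'v set \<Rightarrow> ('v \<Rightarrow> complex) \<Rightarrow> ('v \<Rightarrow> complex) \<Rightarrow> complex" where
  "pairing Vp f \<phi> = (\<Sum>\<^sub>\<infinity>v\<in>Vp. f v * \<phi> v)"

text \<open>
  For unbounded \<open>\<phi>\<close> (and spherical functions can be unbounded) the series
  \<open>\<langle>f, \<phi>\<rangle>\<close> diverges for some \<open>f\<close> in the algebra.  The natural domain of the functional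
  \<open>f \<mapsto> \<langle>f, \<phi>\<rangle>\<close> consists of those \<open>f\<close> for which it converges absolutely;
  for bounded \<open>\<phi>\<close> this is the whole algebra, see \<open>pairing_domain_bounded\<close>.
\<close>

definition pairing_domain ::
  "('v \<Rightarrow> 'v \<Rightarrow> bool) \<Rightarrow> 'v set \<Rightarrow> 'v \<Rightarrow> ('v \<Rightarrow> complex) \<Rightarrow> ('v \<Rightarrow> complex) set" where
  "pairing_domain adj Vp v0 \<phi> =
     {f \<in> ell1_radial adj Vp v0. (\<lambda>v. f v * \<phi> v) abs_summable_on Vp}"

lemma pairing_domain_bounded:
  assumes "bounded (\<phi> ` Vp)"
  shows "pairing_domain adj Vp v0 \<phi> = ell1_radial adj Vp v0"
proof -
  obtain B where B: "\<And>v. v \<in> Vp \<Longrightarrow> norm (\<phi> v) \<le> B"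
    using assms by (auto simp: bounded_iff)
  have "(\<lambda>v. f v * \<phi> v) abs_summable_on Vp" if "f abs_summable_on Vp" for f :: "'a \<Rightarrow> complex"
  proof (rule abs_summable_on_comparison_test')
    show "(\<lambda>v. norm (f v) * B) summable_on Vp"
      using that by (rule summable_on_cmult_left)
    show "norm (f v * \<phi> v) \<le> norm (f v) * B" if "v \<in> Vp" for v
      using B[OF that] by (simp add: norm_mult mult_left_mono)
  qed
  then show ?thesis
    by (auto simp: pairing_domain_def ell1_radial_def)
qed

definition multiplicative_functional ::
  "('v \<Rightarrow> 'v \<Rightarrow> bool) \<Rightarrow> 'v set \<Rightarrow> 'v \<Rightarrow> ('v \<Rightarrow> complex) \<Rightarrow> bool" where
  "multiplicative_functional adj Vp v0 \<phi> \<longleftrightarrow>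
     (\<forall>f\<in>pairing_domain adj Vp v0 \<phi>. \<forall>g\<in>pairing_domain adj Vp v0 \<phi>.
        convolution adj Vp v0 f g \<in> pairing_domain adj Vp v0 \<phi> \<and>
        pairing Vp (convolution adj Vp v0 f g) \<phi> = pairing Vp f \<phi> * pairing Vp g \<phi>)"

end

theory Submission
  imports Defs
begin

text \<open>
  Let \<open>S\<^sub>n f(x)\<close> be the sum of \<open>f\<close> over the sphere of radius \<open>n\<close> around \<open>x\<close>.  The whole proof rests on
  one identity, in which the tree structure is condensed (\<open>sphere_sum_nbr_sum\<close>):
  \<open>S\<^sub>n\<^sub>+\<^sub>1 S\<^sub>1 = S\<^sub>n\<^sub>+\<^sub>2 + b\<^sub>n S\<^sub>n\<close>, where \<open>b\<^sub>n\<close> is the number of outward neighbours of a vertex at distance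
  \<open>n\<close>.  If \<open>f\<close> is an eigenfunction of the Laplace operator with eigenvalue \<open>\<gamma>\<close>, then \<open>S\<^sub>1 f\<close> is a multiple
  of \<open>f\<close> on each sphere and the identity becomes the recurrence that defines the spherical function.
  Hence the mean of \<open>f\<close> over the sphere of radius \<open>n\<close> around any \<open>x \<in> V\<^sub>+\<close> is \<open>\<phi>(n | \<gamma>) f(x)\<close>,
  also when \<open>f\<close> is radial around another vertex (\<open>sphere_sum_eigenfunction\<close>).  For radial \<open>f\<close> and \<open>x = v\<^sub>0\<close> this is the uniqueness
  of the spherical function; for \<open>f = \<phi>\<close> it is the functional equation, because the radialization of
  the translate of \<open>\<phi>\<close> by \<open>\<tau>[v]\<close> is the mean of \<open>\<phi>\<close> over spheres around \<open>\<tau>[v]\<^sup>-\<^sup>1 v\<^sub>0\<close>, a vertex of the same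
  length as \<open>v\<close>.

  Conversely, radius \<open>2\<close> is enough: a radial function on \<open>V\<^sub>+\<close> with \<open>\<phi>(v\<^sub>0) = 1\<close> whose sums over spheres
  of radius \<open>2\<close> are a constant multiple of its values is spherical.  Such a function is determined
  level by level, and since \<open>\<phi>(2 | \<gamma>)\<close> is a quadratic polynomial in \<open>\<gamma>\<close>, some complex \<open>\<gamma>\<close> produces the
  required constant (\<open>spherical_functionI\<close>).  The functional equation gives the constant directly;
  multiplicativity gives it when applied to the indicator functions of the spheres of radius \<open>2\<close> and
  \<open>2k\<close> around \<open>v\<^sub>0\<close>, and the radii \<open>0\<close> and \<open>2k\<close> with \<open>\<phi>(2k) \<noteq> 0\<close> give \<open>\<phi>(v\<^sub>0) = 1\<close>.

  That spherical functions are multiplicative is Fubini's theorem followed by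
  \<open>\<Sum>\<^sub>v f(dist(v,w)) \<phi>(v) = \<phi>(w) \<langle>f, \<phi>\<rangle>\<close>.  The delicate point is absolute convergence, since \<open>\<phi>\<close> may be
  unbounded and \<open>|\<phi>|\<close> satisfies no functional equation.  The even values of \<open>\<phi>\<close> satisfy a linear
  recurrence with two characteristic roots, and its initial values force a dichotomy: either \<open>\<phi>\<close> is
  bounded, or \<open>|\<phi>(v)|\<close> lies between two positive multiples of \<open>R\<^bsup>|v|\<^esup>\<close> for some \<open>R > 1\<close>
  (\<open>recurrence_growth\<close>); in particular an unbounded \<open>\<phi>\<close> has no zeros.  So, with \<open>R = 1\<close> in the first
  case, absolute convergence of \<open>\<langle>f, \<phi>\<rangle>\<close> for \<open>f \<in> \<ell>\<^sup>1\<close> yields \<open>\<Sum>\<^sub>v |f(v)| R\<^bsup>|v|\<^esup> < \<infinity>\<close>, and the weight \<open>R\<^bsup>|v|\<^esup>\<close> is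
  submultiplicative by the triangle inequality, which dominates all the double series.
\<close>

section \<open>Distances and spheres in a semi-homogeneous tree\<close>

locale semihomogeneous =
  fixes adj :: "'v \<Rightarrow> 'v \<Rightarrow> bool" and Vp Vm :: "'v set" and qp qm :: nat
  assumes tree: "semihomogeneous_tree adj Vp Vm qp qm"
    and qp_gt_1: "qp > 1" and qm_gt_1: "qm > 1"
begin

abbreviation d :: "'v \<Rightarrow> 'v \<Rightarrow> nat" where "d \<equiv> gdist adj"

lemma adj_sym: "adj u v \<Longrightarrow> adj v u"
  and connected: "adj\<^sup>*\<^sup>* u v"
  and no_cycle: "\<lbrakk>3 \<le> length xs; distinct xs; successively adj xs\<rbrakk> \<Longrightarrow> \<not> adj (last xs) (hd xs)"
  and Vm_eq: "Vm = - Vp"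
  using tree unfolding semihomogeneous_tree_def is_tree_def by blast+

lemma adj_Vp_iff: "adj u v \<Longrightarrow> v \<in> Vp \<longleftrightarrow> u \<notin> Vp"
  using tree unfolding semihomogeneous_tree_def by blast

text \<open>
  The number of neighbours of a vertex at distance \<open>n\<close> from \<open>x\<close> that lie at distance \<open>n + 1\<close> from \<open>x\<close>,
  see \<open>card_children\<close>: only the centre itself has no neighbour that is closer to the centre.
\<close>

definition branching :: "'v \<Rightarrow> nat \<Rightarrow> nat" where
  "branching x n = (if (x \<in> Vp) = even n then qp else qm) + (if n = 0 then 1 else 0)"

lemma branching_pos: "branching x n > 0"
  using qp_gt_1 qm_gt_1 by (simp add: branching_def)

lemma adj_commute: "adj u v \<longleftrightarrow> adj v u"
  using adj_sym by blast

lemma relpowp_d: "(adj ^^ d u v) u v"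
  unfolding gdist_def using LeastI_ex[OF rtranclp_imp_relpowp[OF connected]] .

lemma d_le: "(adj ^^ n) u v \<Longrightarrow> d u v \<le> n"
  unfolding gdist_def by (rule Least_le)

lemma relpowp_sym: "(adj ^^ n) u v \<Longrightarrow> (adj ^^ n) v u"
proof (induction n arbitrary: v)
  case (Suc n)
  then show ?case by (metis adj_sym relpowp_Suc_E relpowp_Suc_I2)
qed auto

lemma d_commute: "d u v = d v u"
  by (meson antisym d_le relpowp_d relpowp_sym)

lemma d_triangle: "d u w \<le> d u v + d v w"
  by (meson d_le relpowp_d relpowp_trans)

lemma d_self [simp]: "d u u = 0"
  using d_le[of 0 u u] by simp

lemma d_eq_0_iff [simp]: "d u v = 0 \<longleftrightarrow> u = v"
  using relpowp_d[of u v] by auto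

lemma d_adj_le: "adj u w \<Longrightarrow> d w x \<le> Suc (d u x)"
  by (meson d_le relpowp_d relpowp_Suc_I2 adj_sym)

lemma relpowp_Vp_iff: "(adj ^^ n) u v \<Longrightarrow> (v \<in> Vp \<longleftrightarrow> (u \<in> Vp \<longleftrightarrow> even n))"
proof (induction n arbitrary: v)
  case (Suc n)
  then obtain w where "(adj ^^ n) u w" "adj w v" by (auto elim: relpowp_Suc_E)
  then show ?case using Suc.IH[of w] adj_Vp_iff[of w v] by auto
qed auto

lemma Vp_iff_even_d: "x \<in> Vp \<Longrightarrow> v \<in> Vp \<longleftrightarrow> even (d v x)"
  using relpowp_Vp_iff[OF relpowp_d[of v x]] by auto

text \<open>
  Neighbours never have the same distance to \<open>x\<close>, because the parity of the distance to \<open>x\<close> tells to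
  which of the two classes a vertex belongs.
\<close>

lemma d_adj: "adj u w \<Longrightarrow> d w x = Suc (d u x) \<or> d u x = Suc (d w x)"
proof -
  assume a: "adj u w"
  have "even (d u x) \<noteq> even (d w x)"
    using relpowp_Vp_iff[OF relpowp_d[of u x]] relpowp_Vp_iff[OF relpowp_d[of w x]]
      adj_Vp_iff[OF a] by blast
  then have "d u x \<noteq> d w x" by metis
  then show ?thesis
    using d_adj_le[OF a, of x] d_adj_le[OF adj_sym[OF a], of x] by linarith
qed

lemma ex_parent: "d y x = Suc n \<Longrightarrow> \<exists>u. adj y u \<and> d u x = n"
proof -
  assume a: "d y x = Suc n"
  then obtain u where u: "adj y u" "(adj ^^ n) u x"
    using relpowp_d[of y x] by (metis relpowp_Suc_E2)
  then have "d u x \<le> n" using d_le by blast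
  then show ?thesis using u(1) a d_adj[OF u(1), of x] by auto
qed

text \<open>
  Follow the parents of \<open>u\<close> and of \<open>w\<close> towards \<open>x\<close> until they meet.  As all vertices of the path stay
  in the ball of radius \<open>n\<close>, a common neighbour of \<open>u\<close> and \<open>w\<close> outside this ball would close a cycle.
\<close>

lemma ex_path_within_ball:
  assumes "u \<noteq> w" "d u x = n" "d w x = n"
  shows "\<exists>p. 2 \<le> length p \<and> hd p = u \<and> last p = w \<and> distinct p \<and> successively adj p \<and>
             (\<forall>z\<in>set p. d z x \<le> n)"
  using assms
proof (induction n arbitrary: u w)
  case (Suc n)
  obtain u' where u': "adj u u'" "d u' x = n" using ex_parent Suc.prems by blast
  obtain w' where w': "adj w w'" "d w' x = n" using ex_parent Suc.prems by blast
  show ?case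
  proof (cases "u' = w'")
    case True
    then show ?thesis using u' w' Suc.prems adj_sym
      by (intro exI[of _ "[u, u', w]"]) auto
  next
    case False
    then obtain p where p: "2 \<le> length p" "hd p = u'" "last p = w'" "distinct p"
      "successively adj p" "\<forall>z\<in>set p. d z x \<le> n"
      using Suc.IH[OF _ u'(2) w'(2)] by blast
    moreover have "u \<notin> set p" "w \<notin> set p" using p(6) Suc.prems by auto
    ultimately show ?thesis using u' w' Suc.prems adj_sym[OF w'(1)]
      by (intro exI[of _ "u # p @ [w]"])
         (auto simp: successively_Cons successively_append_iff hd_append)
  qed
qed auto

lemma unique_parent:
  assumes "d y x = Suc n" "adj y u" "adj y w" "d u x = n" "d w x = n"
  shows "u = w"
proof (rule ccontr)
  assume "u \<noteq> w"
  then obtain p where p: "2 \<le> length p" "hd p = u" "last p = w" "distinct p"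
      "successively adj p" "\<forall>z\<in>set p. d z x \<le> n"
    using ex_path_within_ball[OF _ assms(4,5)] by blast
  have "y \<notin> set p" using p(6) assms(1) by auto
  with p have "\<not> adj (last (y # p)) (hd (y # p))"
    by (intro no_cycle) (use assms(2) in \<open>auto simp: successively_Cons\<close>)
  then show False using p assms(3) adj_sym by (auto split: if_splits)
qed

lemma card_nbrs: "card {w. adj v w} = (if v \<in> Vp then qp else qm) + 1"
  using tree Vm_eq unfolding semihomogeneous_tree_def by auto

lemma finite_nbrs: "finite {w. adj v w}"
  using card_nbrs[of v] by (metis card.infinite add_is_0 one_neq_zero)

lemma finite_nbrs_filter [simp]: "finite {w. adj v w \<and> P w}"
  by (rule finite_subset[OF _ finite_nbrs[of v]]) blast

lemma nbrs_eq:
  assumes "d y x = n"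
  shows "{w. adj y w} = {w. adj y w \<and> d w x = Suc n} \<union> {w. adj y w \<and> Suc (d w x) = n}"
  using d_adj[of y _ x] assms by force

lemma parents_eq_singleton:
  assumes "d y x = Suc n"
  obtains u where "{w. adj y w \<and> d w x = n} = {u}"
proof -
  obtain u where "adj y u" "d u x = n" using ex_parent[OF assms] by blast
  then have "{w. adj y w \<and> d w x = n} = {u}" using unique_parent[OF assms] by blast
  then show ?thesis by (rule that)
qed

lemma card_children:
  assumes "d y x = n"
  shows "card {w. adj y w \<and> d w x = Suc n} = branching x n"
proof -
  have "y \<in> Vp \<longleftrightarrow> (x \<in> Vp \<longleftrightarrow> even n)"
    using relpowp_Vp_iff[OF relpowp_d[of y x]] assms by auto
  then have q: "branching x n = (if y \<in> Vp then qp else qm) + (if n = 0 then 1 else 0)"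
    by (simp add: branching_def)
  have "card {w. adj y w} = card {w. adj y w \<and> d w x = Suc n} + card {w. adj y w \<and> Suc (d w x) = n}"
    by (subst nbrs_eq[OF assms], intro card_Un_disjoint) auto
  moreover have "card {w. adj y w \<and> Suc (d w x) = n} = (if n = 0 then 0 else 1)"
  proof (cases n)
    case (Suc m)
    then obtain u where "{w. adj y w \<and> d w x = m} = {u}"
      using parents_eq_singleton assms by metis
    then show ?thesis using Suc by simp
  qed simp
  ultimately show ?thesis unfolding q card_nbrs by auto
qed

lemma circle_0: "circle adj x 0 = {x}"
  by (auto simp: circle_def)

lemma circle_1: "circle adj x 1 = {w. adj x w}"
proof -
  have "adj x w" if "d w x = 1" for w
    using ex_parent[of w x 0] that by (auto dest: adj_sym)
  moreover have "d w x = 1" if "adj x w" for w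
    using d_adj[OF that, of x] by simp
  ultimately have "d w x = 1 \<longleftrightarrow> adj x w" for w by blast
  then show ?thesis by (simp add: circle_def)
qed

lemma finite_circle [simp]: "finite (circle adj x n)"
proof (induction n)
  case (Suc n)
  have "circle adj x (Suc n) \<subseteq> (\<Union>u\<in>circle adj x n. {w. adj u w})"
    using ex_parent adj_sym by (fastforce simp: circle_def)
  then show ?case using Suc finite_nbrs by (auto intro: finite_subset)
qed (simp add: circle_0)

lemma card_nbrs_outwards:
  assumes "w \<in> circle adj x n"
  shows "card {u \<in> circle adj x (Suc n). adj u w} = branching x n"
proof -
  have "{u \<in> circle adj x (Suc n). adj u w} = {u. adj w u \<and> d u x = Suc n}"
    using adj_sym by (fastforce simp: circle_def)
  then show ?thesis using card_children[of w x n] assms by (simp add: circle_def)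
qed

lemma card_nbrs_inwards:
  assumes "w \<in> circle adj x (Suc n)"
  shows "card {u \<in> circle adj x n. adj u w} = 1"
proof -
  obtain z where "{u. adj w u \<and> d u x = n} = {z}"
    using parents_eq_singleton[of w x n] assms by (auto simp: circle_def)
  moreover have "{u \<in> circle adj x n. adj u w} = {u. adj w u \<and> d u x = n}"
    using adj_sym by (fastforce simp: circle_def)
  ultimately show ?thesis by simp
qed

section \<open>Sums over spheres\<close>

definition sphere_sum :: "'v \<Rightarrow> nat \<Rightarrow> ('v \<Rightarrow> complex) \<Rightarrow> complex" where
  "sphere_sum x n g = (\<Sum>u\<in>circle adj x n. g u)"

definition nbr_sum :: "('v \<Rightarrow> complex) \<Rightarrow> 'v \<Rightarrow> complex" where
  "nbr_sum g v = (\<Sum>w | adj v w. g w)"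

lemma sphere_sum_0 [simp]: "sphere_sum x 0 g = g x"
  by (simp add: sphere_sum_def circle_0)

lemma sphere_sum_1: "sphere_sum x (Suc 0) g = nbr_sum g x"
  using circle_1[of x] by (simp add: sphere_sum_def nbr_sum_def)

text \<open>
  Double counting of the adjacent pairs \<open>(u, w)\<close> with \<open>d u x = n + 1\<close>: the vertex \<open>w\<close> lies on the sphere
  of radius \<open>n\<close>, where it is met \<open>branching x n\<close> times, or on the sphere of radius \<open>n + 2\<close>, where its
  parent is the only \<open>u\<close>.
\<close>

lemma sphere_sum_nbr_sum:
  "sphere_sum x (Suc n) (nbr_sum g) = sphere_sum x (Suc (Suc n)) g + of_nat (branching x n) * sphere_sum x n g"
proof -
  let ?C = "circle adj x"
  have "sphere_sum x (Suc n) (nbr_sum g)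
      = (\<Sum>u\<in>?C (Suc n). \<Sum>w | w \<in> ?C n \<union> ?C (Suc (Suc n)) \<and> adj u w. g w)"
    unfolding sphere_sum_def nbr_sum_def
  proof (intro sum.cong refl)
    fix u assume "u \<in> ?C (Suc n)"
    then show "{w. adj u w} = {w. w \<in> ?C n \<union> ?C (Suc (Suc n)) \<and> adj u w}"
      using d_adj[of u _ x] by (auto simp: circle_def)
  qed
  also have "\<dots> = (\<Sum>w\<in>?C n \<union> ?C (Suc (Suc n)). \<Sum>u | u \<in> ?C (Suc n) \<and> adj u w. g w)"
    by (rule sum.swap_restrict) auto
  also have "\<dots> = (\<Sum>w\<in>?C n. \<Sum>u | u \<in> ?C (Suc n) \<and> adj u w. g w)
       + (\<Sum>w\<in>?C (Suc (Suc n)). \<Sum>u | u \<in> ?C (Suc n) \<and> adj u w. g w)"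
    by (rule sum.union_disjoint[OF finite_circle finite_circle]) (auto simp: circle_def)
  also have "(\<Sum>w\<in>?C n. \<Sum>u | u \<in> ?C (Suc n) \<and> adj u w. g w) = of_nat (branching x n) * sphere_sum x n g"
    by (simp add: sphere_sum_def card_nbrs_outwards sum_distrib_left)
  also have "(\<Sum>w\<in>?C (Suc (Suc n)). \<Sum>u | u \<in> ?C (Suc n) \<and> adj u w. g w) = sphere_sum x (Suc (Suc n)) g"
    by (simp add: sphere_sum_def card_nbrs_inwards)
  finally show ?thesis by simp
qed

lemma nbr_sum_radial:
  assumes "\<And>v. g v = G (d v x)"
  shows "nbr_sum g x = of_nat (branching x 0) * G 1"
    and "d y x = Suc n \<Longrightarrow> nbr_sum g y = G n + of_nat (branching x (Suc n)) * G (Suc (Suc n))"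
proof -
  have *: "nbr_sum g y = (\<Sum>w | adj y w \<and> d w x = Suc n. g w) + (\<Sum>w | adj y w \<and> Suc (d w x) = n. g w)"
    if "d y x = n" for y n
    unfolding nbr_sum_def
    by (subst nbrs_eq[OF that], intro sum.union_disjoint) auto
  have c: "(\<Sum>w | adj y w \<and> d w x = Suc n. g w) = of_nat (branching x n) * G (Suc n)" if "d y x = n" for y n
    using card_children[OF that] by (simp add: assms)
  show "nbr_sum g x = of_nat (branching x 0) * G 1"
    using *[of x 0] c[of x 0] by simp
  show "nbr_sum g y = G n + of_nat (branching x (Suc n)) * G (Suc (Suc n))" if y: "d y x = Suc n"
  proof -
    obtain u where "{w. adj y w \<and> d w x = n} = {u}" by (rule parents_eq_singleton[OF y])
    moreover from this have "d u x = n" by blast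
    ultimately have "(\<Sum>w | adj y w \<and> Suc (d w x) = Suc n. g w) = G n" by (simp add: assms)
    then show ?thesis using *[OF y] c[OF y] by simp
  qed
qed

lemma card_circle_Suc: "card (circle adj x (Suc n)) = branching x n * card (circle adj x n)"
proof -
  let ?C = "circle adj x"
  have "(\<Sum>u\<in>?C (Suc n). \<Sum>w | w \<in> ?C n \<and> adj w u. 1)
      = (\<Sum>w\<in>?C n. \<Sum>u | u \<in> ?C (Suc n) \<and> adj w u. (1::nat))"
    by (rule sum.swap_restrict) auto
  also have "\<dots> = (\<Sum>w\<in>?C n. card {u \<in> ?C (Suc n). adj u w})"
    by (simp add: adj_commute)
  finally show ?thesis by (simp add: card_nbrs_outwards card_nbrs_inwards)
qed

lemma card_circle_pos: "card (circle adj x n) > 0"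
  by (induction n) (auto simp: circle_0 card_circle_Suc branching_pos)

lemma circle_nonempty: "\<exists>v. d v x = n"
  using card_circle_pos[of x n] by (auto simp: card_gt_0_iff circle_def)

lemma radial_profile:
  assumes "radial_on adj x UNIV g"
  obtains G where "\<And>v. g v = G (d v x)"
proof -
  have "g v = g (SOME u. d u x = d v x)" for v
    using assms someI[of "\<lambda>u. d u x = d v x" v] unfolding radial_on_def by (metis UNIV_I)
  then show ?thesis using that[of "\<lambda>n. g (SOME u. d u x = n)"] by blast
qed

lemma radial_nbr_sum:
  assumes "radial_on adj x UNIV g"
  shows "radial_on adj x UNIV (nbr_sum g)"
proof -
  obtain G where G: "\<And>v. g v = G (d v x)" by (rule radial_profile[OF assms]) blast
  have "nbr_sum g u = nbr_sum g v" if "d u x = d v x" for u v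
    using nbr_sum_radial[of g G x, OF G] that by (cases "d v x") auto
  then show ?thesis unfolding radial_on_def by blast
qed

lemma branching_cong: "d u x = d v x \<Longrightarrow> branching u n = branching v n"
  using relpowp_Vp_iff[OF relpowp_d[of u x]] relpowp_Vp_iff[OF relpowp_d[of v x]]
  by (auto simp: branching_def)

text \<open>
  By \<open>sphere_sum_nbr_sum\<close> the operator of sums over spheres of radius \<open>n\<close> is built from the neighbour
  sum and from numbers that depend only on the class of the centre, and these preserve radial
  functions.  This replaces the transitivity of the stabilizer of \<open>x\<close> on the spheres around \<open>x\<close>.
\<close>

lemma radial_sphere_sum:
  assumes "radial_on adj x UNIV g"
  shows "radial_on adj x UNIV (\<lambda>v. sphere_sum v n g)"
  using assms
proof (induction n arbitrary: g rule: less_induct)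
  case (less n)
  show ?case
  proof (cases "n \<le> 1")
    case True
    then show ?thesis using less.prems radial_nbr_sum[OF less.prems]
      by (cases n) (auto simp: sphere_sum_1)
  next
    case False
    then obtain k where k: "n = Suc (Suc k)" by (cases n; cases "n - 1") auto
    have 1: "radial_on adj x UNIV (\<lambda>v. sphere_sum v (Suc k) (nbr_sum g))"
      using less.IH[of "Suc k"] radial_nbr_sum[OF less.prems] k by simp
    have 2: "radial_on adj x UNIV (\<lambda>v. sphere_sum v k g)"
      using less.IH[of k] less.prems k by simp
    have "sphere_sum v n g = sphere_sum v (Suc k) (nbr_sum g) - of_nat (branching v k) * sphere_sum v k g" for v
      by (simp add: sphere_sum_nbr_sum k)
    then show ?thesis using 1 2 branching_cong unfolding radial_on_def by metis
  qed
qed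

section \<open>Automorphisms\<close>

lemma aut_surj: "T \<in> graph_aut adj \<Longrightarrow> \<exists>z. y = T z"
  by (simp add: graph_aut_def bij_def surj_def)

lemma aut_inj: "T \<in> graph_aut adj \<Longrightarrow> inj T"
  by (simp add: graph_aut_def bij_def)

lemma relpowp_aut:
  assumes "T \<in> graph_aut adj"
  shows "(adj ^^ n) (T u) (T v) \<longleftrightarrow> (adj ^^ n) u v"
proof (induction n arbitrary: v)
  case 0
  then show ?case using aut_inj[OF assms] by (auto simp: inj_eq)
next
  case (Suc n)
  have "(adj ^^ Suc n) (T u) (T v) \<longleftrightarrow> (\<exists>y. (adj ^^ n) (T u) y \<and> adj y (T v))" by auto
  also have "\<dots> \<longleftrightarrow> (\<exists>z. (adj ^^ n) (T u) (T z) \<and> adj (T z) (T v))"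
    using aut_surj[OF assms] by metis
  also have "\<dots> \<longleftrightarrow> (adj ^^ Suc n) u v"
    using Suc assms by (auto simp: graph_aut_def)
  finally show ?case .
qed

lemma d_aut: "T \<in> graph_aut adj \<Longrightarrow> d (T u) (T v) = d u v"
  unfolding gdist_def by (simp add: relpowp_aut)

lemma bij_betw_aut_restrict:
  assumes "T \<in> graph_aut adj" "\<And>u. T u \<in> B \<longleftrightarrow> u \<in> A"
  shows "bij_betw T A B"
proof -
  have "T ` A = B"
  proof
    show "B \<subseteq> T ` A"
    proof
      fix y assume "y \<in> B"
      moreover obtain z where "y = T z" using aut_surj[OF assms(1)] by blast
      ultimately show "y \<in> T ` A" using assms(2) by blast
    qed
  qed (use assms(2) in blast)
  moreover have "inj_on T A" using aut_inj[OF assms(1)] by (rule inj_on_subset) simp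
  ultimately show ?thesis by (simp add: bij_betw_def)
qed

lemma bij_betw_aut_circle:
  "T \<in> graph_aut adj \<Longrightarrow> bij_betw T (circle adj x n) (circle adj (T x) n)"
  by (rule bij_betw_aut_restrict) (simp_all add: circle_def d_aut)

lemma bij_betw_aut_Vp:
  assumes "T \<in> graph_aut adj" "x \<in> Vp" "T x \<in> Vp"
  shows "bij_betw T Vp Vp"
proof (rule bij_betw_aut_restrict[OF assms(1)])
  show "T u \<in> Vp \<longleftrightarrow> u \<in> Vp" for u
    using Vp_iff_even_d[OF assms(3), of "T u"] Vp_iff_even_d[OF assms(2), of u] d_aut[OF assms(1), of u x]
    by simp
qed

section \<open>Spherical functions\<close>

text \<open>
  The values \<open>\<phi>(n | \<gamma>)\<close> of the spherical function around a vertex of \<open>V\<^sub>+\<close>, see \<open>spherical_phi_eq\<close>: the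
  eigenvalue equation at a vertex of length \<open>n + 1\<close>, solved for the value at length \<open>n + 2\<close>.
\<close>

fun sph :: "complex \<Rightarrow> nat \<Rightarrow> complex" where
  "sph \<gamma> 0 = 1"
| "sph \<gamma> (Suc 0) = \<gamma>"
| "sph \<gamma> (Suc (Suc n)) =
     (of_nat ((if even (Suc n) then qp else qm) + 1) * \<gamma> * sph \<gamma> (Suc n) - sph \<gamma> n)
       / of_nat (if even (Suc n) then qp else qm)"

lemma circle_not_empty [simp]: "circle adj x n \<noteq> {}"
  using card_circle_pos[of x n] by auto

lemma laplace_eq_iff:
  "laplace adj Vp qp qm f v = c \<longleftrightarrow> nbr_sum f v = of_nat ((if v \<in> Vp then qp else qm) + 1) * c"
proof -
  have "of_nat ((if v \<in> Vp then qp else qm) + 1) \<noteq> (0::complex)"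
    by (metis add_is_0 of_nat_eq_0_iff one_neq_zero)
  then show ?thesis unfolding laplace_def nbr_sum_def by (simp only: divide_eq_eq mult.commute) auto
qed

lemma branching_Vp_Suc: "x \<in> Vp \<Longrightarrow> branching x (Suc n) = (if even (Suc n) then qp else qm)"
  by (simp add: branching_def)

lemma branching_Vp_0: "x \<in> Vp \<Longrightarrow> branching x 0 = qp + 1"
  by (simp add: branching_def)

lemma sph_Suc_Suc:
  assumes "x \<in> Vp"
  shows "of_nat (branching x (Suc n)) * sph \<gamma> (Suc (Suc n)) = of_nat (branching x (Suc n) + 1) * \<gamma> * sph \<gamma> (Suc n) - sph \<gamma> n"
proof -
  have "of_nat (branching x (Suc n)) \<noteq> (0::complex)" using branching_pos[of x "Suc n"] by simp
  then show ?thesis unfolding sph.simps branching_Vp_Suc[OF assms, symmetric] by simp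
qed

text \<open>
  The mean value property.  On the sphere of radius \<open>n + 1\<close> around \<open>x\<close> the degree is constant, so that
  the left-hand side of \<open>sphere_sum_nbr_sum\<close> is a multiple of \<open>sphere_sum x (n + 1) f\<close>; what remains
  is the recurrence of \<open>sph\<close>.
\<close>

lemma sphere_sum_eigenfunction:
  assumes f: "\<And>v. laplace adj Vp qp qm f v = \<gamma> * f v" and x: "x \<in> Vp"
  shows "sphere_sum x n f = of_nat (card (circle adj x n)) * sph \<gamma> n * f x"
proof -
  have N: "nbr_sum f v = of_nat ((if v \<in> Vp then qp else qm) + 1) * (\<gamma> * f v)" for v
    using f laplace_eq_iff by blast
  show ?thesis
  proof (induction n rule: induct_nat_012)
    case (ge2 n)
    let ?c = "\<lambda>n. of_nat (card (circle adj x n)) :: complex"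
    have "sphere_sum x (Suc n) (nbr_sum f) = of_nat (branching x (Suc n) + 1) * \<gamma> * sphere_sum x (Suc n) f"
      unfolding sphere_sum_def sum_distrib_left
    proof (intro sum.cong refl)
      fix u assume "u \<in> circle adj x (Suc n)"
      then have "d u x = Suc n" by (simp add: circle_def)
      then show "nbr_sum f u = of_nat (branching x (Suc n) + 1) * \<gamma> * f u"
        using Vp_iff_even_d[OF x, of u] x by (simp add: N branching_Vp_Suc)
    qed
    then have "sphere_sum x (Suc (Suc n)) f
        = of_nat (branching x (Suc n) + 1) * \<gamma> * sphere_sum x (Suc n) f - of_nat (branching x n) * sphere_sum x n f"
      using sphere_sum_nbr_sum[of x n f] by (simp add: eq_diff_eq)
    also have "\<dots> = ?c (Suc n) * (of_nat (branching x (Suc n) + 1) * \<gamma> * sph \<gamma> (Suc n) - sph \<gamma> n) * f x"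
      by (simp add: ge2 card_circle_Suc algebra_simps del: sph.simps)
    also have "\<dots> = ?c (Suc (Suc n)) * sph \<gamma> (Suc (Suc n)) * f x"
      unfolding sph_Suc_Suc[OF x, symmetric] card_circle_Suc[of x "Suc n"] by (simp del: sph.simps)
    finally show ?case .
  qed (simp_all add: circle_0 sphere_sum_1 N x card_circle_Suc branching_Vp_0)
qed

lemma laplace_sph:
  assumes x: "x \<in> Vp"
  shows "laplace adj Vp qp qm (\<lambda>v. sph \<gamma> (d v x)) v = \<gamma> * sph \<gamma> (d v x)"
proof (cases "d v x")
  case 0
  then have "v = x" by simp
  then show ?thesis
    using nbr_sum_radial(1)[of "\<lambda>v. sph \<gamma> (d v x)" "sph \<gamma>" x] x by (simp add: laplace_eq_iff branching_Vp_0)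
next
  case (Suc n)
  have "nbr_sum (\<lambda>v. sph \<gamma> (d v x)) v = of_nat (branching x (Suc n) + 1) * \<gamma> * sph \<gamma> (Suc n)"
    using nbr_sum_radial(2)[of "\<lambda>v. sph \<gamma> (d v x)" "sph \<gamma>" x, OF refl Suc]
      sph_Suc_Suc[OF x, of n \<gamma>] by simp
  then show ?thesis
    using Vp_iff_even_d[OF x, of v] x by (simp add: laplace_eq_iff branching_Vp_Suc Suc del: sph.simps)
qed

text \<open>
  Existence is the eigenvalue equation for \<open>sph\<close>; uniqueness is the mean value property at the root,
  where the mean of a radial function over a sphere is its value there.
\<close>

lemma spherical_phi_eq:
  assumes x: "x \<in> Vp"
  shows "spherical_phi adj Vp qp qm x \<gamma> = (\<lambda>v. sph \<gamma> (d v x))"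
  unfolding spherical_phi_def
proof (rule the_equality)
  show "radial_on adj x UNIV (\<lambda>v. sph \<gamma> (d v x)) \<and>
    (\<forall>v. laplace adj Vp qp qm (\<lambda>v. sph \<gamma> (d v x)) v = \<gamma> * sph \<gamma> (d v x)) \<and> sph \<gamma> (d x x) = 1"
    using laplace_sph[OF x] by (simp add: radial_on_def)
next
  fix f assume f: "radial_on adj x UNIV f \<and> (\<forall>v. laplace adj Vp qp qm f v = \<gamma> * f v) \<and> f x = 1"
  show "f = (\<lambda>v. sph \<gamma> (d v x))"
  proof
    fix v
    let ?C = "circle adj x (d v x)"
    have "\<And>u. u \<in> ?C \<Longrightarrow> f u = f v" using f unfolding radial_on_def circle_def by blast
    then have "of_nat (card ?C) * f v = sphere_sum x (d v x) f" by (simp add: sphere_sum_def)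
    also have "\<dots> = of_nat (card ?C) * sph \<gamma> (d v x)"
      using sphere_sum_eigenfunction[of f \<gamma> x] f x by simp
    finally show "f v = sph \<gamma> (d v x)" using card_circle_pos[of x "d v x"] by simp
  qed
qed

lemma spherical_function_iff:
  assumes "x \<in> Vp"
  shows "spherical_function adj Vp qp qm x f \<longleftrightarrow> (\<exists>\<gamma>. \<forall>v\<in>Vp. f v = sph \<gamma> (d v x))"
  by (simp add: spherical_function_def spherical_phi_eq[OF assms])

lemma sphere_subset_Vp: "x \<in> Vp \<Longrightarrow> even n \<Longrightarrow> circle adj x n \<subseteq> Vp"
  using Vp_iff_even_d by (auto simp: circle_def)

lemma card_circle_Vp: "x \<in> Vp \<Longrightarrow> y \<in> Vp \<Longrightarrow> card (circle adj x n) = card (circle adj y n)"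
  by (induction n) (simp_all add: circle_0 card_circle_Suc branching_def)

lemma sphere_sum_spherical:
  assumes "x \<in> Vp" "y \<in> Vp" "even n" "\<And>v. v \<in> Vp \<Longrightarrow> f v = sph \<gamma> (d v y)"
  shows "sphere_sum x n f = of_nat (card (circle adj y n)) * sph \<gamma> n * f x"
proof -
  have "sphere_sum x n f = sphere_sum x n (\<lambda>v. sph \<gamma> (d v y))"
    unfolding sphere_sum_def using sphere_subset_Vp[OF assms(1,3)] assms(4) by (intro sum.cong) auto
  also have "\<dots> = of_nat (card (circle adj x n)) * sph \<gamma> n * sph \<gamma> (d x y)"
    by (rule sphere_sum_eigenfunction[OF laplace_sph[OF assms(2)] assms(1)])
  finally show ?thesis using assms(1,4) card_circle_Vp[OF assms(1,2)] by simp
qed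

text \<open>
  Induction on the length of \<open>v\<close>.  Let \<open>y\<close> be the grandparent of \<open>v\<close>.  The sphere of radius \<open>2\<close> around
  \<open>y\<close> contains, besides vertices shorter than \<open>v\<close>, only vertices of the length of \<open>v\<close>, and \<open>v\<close> is one
  of them; so the equation at \<open>y\<close> reduces to a positive multiple of \<open>f v\<close> being zero.
\<close>

lemma radial_vanish:
  assumes x: "x \<in> Vp" and r: "radial_on adj x Vp f" and "f x = 0"
    and e: "\<And>y. y \<in> Vp \<Longrightarrow> sphere_sum y 2 f = c * f y"
    and "v \<in> Vp"
  shows "f v = 0"
  using \<open>v \<in> Vp\<close>
proof (induction "d v x" arbitrary: v rule: less_induct)
  case less
  show ?case
  proof (cases "d v x = 0")
    case True
    then show ?thesis using \<open>f x = 0\<close> by simp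
  next
    case False
    moreover have "even (d v x)" using Vp_iff_even_d[OF x] less.prems by blast
    ultimately obtain k where k: "d v x = Suc (Suc k)"
      by (metis even_Suc even_zero old.nat.exhaust)
    obtain u where u: "adj v u" "d u x = Suc k" using ex_parent[OF k] by blast
    obtain y where y: "adj u y" "d y x = k" using ex_parent[OF u(2)] by blast
    have yV: "y \<in> Vp" using Vp_iff_even_d[OF x] \<open>even (d v x)\<close> k y(2) by simp
    have "d v y \<le> 2"
      using d_le[of 2 v y] u(1) y(1) by (metis One_nat_def Suc_1 relpowp_Suc_0 relpowp_Suc_I)
    moreover have "d v x \<le> d v y + d y x" by (rule d_triangle)
    ultimately have dvy: "d v y = 2" using k y(2) by simp
    let ?S = "{w \<in> circle adj y 2. d w x = d v x}"
    have "sphere_sum y 2 f = (\<Sum>w\<in>?S. f w)"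
      unfolding sphere_sum_def
    proof (rule sum.mono_neutral_right)
      show "\<forall>w\<in>circle adj y 2 - ?S. f w = 0"
      proof
        fix w assume w: "w \<in> circle adj y 2 - ?S"
        then have "w \<in> Vp" using sphere_subset_Vp[OF yV, of 2] by auto
        have "d w x \<le> d w y + d y x" by (rule d_triangle)
        then have "d w x < d v x" using w k y(2) by (auto simp: circle_def)
        then show "f w = 0" using less.hyps \<open>w \<in> Vp\<close> by blast
      qed
    qed auto
    also have "\<dots> = (\<Sum>w\<in>?S. f v)"
    proof (rule sum.cong)
      fix w assume "w \<in> ?S"
      moreover from this have "w \<in> Vp" using sphere_subset_Vp[OF yV, of 2] by auto
      ultimately show "f w = f v" using r less.prems unfolding radial_on_def by blast
    qed simp
    finally have "of_nat (card ?S) * f v = c * f y" using e[OF yV] by simp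
    moreover have "f y = 0" using less.hyps[of y] yV k y(2) by simp
    moreover have "v \<in> ?S" using dvy by (simp add: circle_def)
    ultimately show ?thesis by auto
  qed
qed

text \<open>
  Choose \<open>\<gamma>\<close> such that the spherical function has the same constant \<open>c\<close>.  Its difference to \<open>f\<close>
  vanishes at the root, hence everywhere by \<open>radial_vanish\<close>.
\<close>

lemma spherical_functionI:
  assumes x: "x \<in> Vp" and r: "radial_on adj x Vp f" and "f x = 1"
    and e: "\<And>y. y \<in> Vp \<Longrightarrow> sphere_sum y 2 f = c * f y"
  shows "spherical_function adj Vp qp qm x f"
proof -
  define N :: complex where "N = of_nat (card (circle adj x 2))"
  have N: "N \<noteq> 0" using card_circle_pos[of x 2] by (simp add: N_def)
  \<comment> \<open>A root of \<open>sph \<gamma> 2 = c / N\<close>, that is, of \<open>((qm + 1) * \<gamma>\<^sup>2 - 1) / qm = c / N\<close>.\<close>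
  define \<gamma> where "\<gamma> = csqrt ((of_nat qm * (c / N) + 1) / of_nat (qm + 1))"
  have q: "of_nat (qm + 1) \<noteq> (0::complex)" "of_nat qm \<noteq> (0::complex)"
    using qm_gt_1 by (simp_all del: of_nat_add of_nat_Suc)
  have "\<gamma>\<^sup>2 = (of_nat qm * (c / N) + 1) / of_nat (qm + 1)"
    unfolding \<gamma>_def by (rule power2_csqrt)
  then have "of_nat (qm + 1) * \<gamma>\<^sup>2 = of_nat qm * (c / N) + 1"
    using q(1) by (metis nonzero_eq_divide_eq mult.commute)
  then have "sph \<gamma> 2 = c / N"
    using q(2) by (simp add: numeral_2_eq_2 power2_eq_square mult.assoc)
  define h where "h v = f v - sph \<gamma> (d v x)" for v
  have "h v = 0" if "v \<in> Vp" for v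
  proof (rule radial_vanish[OF x _ _ _ that])
    show "radial_on adj x Vp h" using r unfolding radial_on_def h_def by metis
    show "h x = 0" using \<open>f x = 1\<close> by (simp add: h_def)
    show "sphere_sum y 2 h = c * h y" if "y \<in> Vp" for y
    proof -
      have "sphere_sum y 2 h = sphere_sum y 2 f - sphere_sum y 2 (\<lambda>v. sph \<gamma> (d v x))"
        by (simp add: sphere_sum_def h_def sum_subtractf)
      also have "sphere_sum y 2 (\<lambda>v. sph \<gamma> (d v x)) = c * sph \<gamma> (d y x)"
        using sphere_sum_spherical[OF that x, of 2 "\<lambda>v. sph \<gamma> (d v x)" \<gamma>] \<open>sph \<gamma> 2 = c / N\<close> N
        by (simp add: N_def)
      also have "sphere_sum y 2 f - c * sph \<gamma> (d y x) = c * h y"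
        by (simp add: e[OF that] h_def algebra_simps)
      finally show ?thesis .
    qed
  qed
  then show ?thesis unfolding spherical_function_iff[OF x] h_def by (metis eq_iff_diff_eq_0)
qed

lemma radial_onD: "radial_on adj x S f \<Longrightarrow> u \<in> S \<Longrightarrow> v \<in> S \<Longrightarrow> d u x = d v x \<Longrightarrow> f u = f v"
  unfolding radial_on_def by blast

lemma radial_sphere_sum_Vp:
  assumes x: "x \<in> Vp" and f: "radial_on adj x Vp f" and n: "even n"
  shows "radial_on adj x Vp (\<lambda>v. sphere_sum v n f)"
proof -
  define g where "g v = (if v \<in> Vp then f v else 0)" for v
  have "g u = g v" if "d u x = d v x" for u v
  proof -
    have "u \<in> Vp \<longleftrightarrow> v \<in> Vp" using Vp_iff_even_d[OF x] that by simp
    moreover have "f u = f v" if "u \<in> Vp" "v \<in> Vp"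
      using f that \<open>d u x = d v x\<close> unfolding radial_on_def by blast
    ultimately show ?thesis by (simp add: g_def)
  qed
  then have "radial_on adj x UNIV g" unfolding radial_on_def by blast
  then have g: "radial_on adj x UNIV (\<lambda>v. sphere_sum v n g)" by (rule radial_sphere_sum)
  have eq: "sphere_sum v n g = sphere_sum v n f" if "v \<in> Vp" for v
    unfolding sphere_sum_def g_def using sphere_subset_Vp[OF that n] by (intro sum.cong) auto
  show ?thesis
    unfolding radial_on_def
  proof (intro ballI impI)
    fix u v assume "u \<in> Vp" "v \<in> Vp" "d u x = d v x"
    then show "sphere_sum u n f = sphere_sum v n f"
      using radial_onD[OF g, of u v] eq[of u] eq[of v] by simp
  qed
qed

section \<open>The functional equation\<close>

lemma inv_aut:
  assumes "T \<in> graph_aut adj"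
  shows "inv T \<in> graph_aut adj"
proof -
  have b: "bij T" using assms by (simp add: graph_aut_def)
  have "adj (inv T u) (inv T v) \<longleftrightarrow> adj u v" for u v
    using assms surj_f_inv_f[OF bij_is_surj[OF b]] unfolding graph_aut_def
    by (metis (mono_tags, lifting) mem_Collect_eq)
  then show ?thesis by (simp add: graph_aut_def bij_imp_bij_inv[OF b])
qed

text \<open>
  Radializing a translate averages \<open>f\<close> over a sphere around \<open>inv T x\<close>, the vertex that \<open>T\<close> moves to
  the root.
\<close>

lemma radialize_translate:
  assumes "T \<in> graph_aut adj"
  shows "radialize adj x (translate T f) w
       = sphere_sum (inv T x) (d w x) f / of_nat (card (circle adj x (d w x)))"
proof -
  have "(\<Sum>u\<in>circle adj x (d w x). f (inv T u)) = (\<Sum>u\<in>circle adj (inv T x) (d w x). f u)"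
    by (rule sum.reindex_bij_betw[OF bij_betw_aut_circle[OF inv_aut[OF assms]]])
  then show ?thesis by (simp add: radialize_def sphere_sum_def translate_def)
qed

lemma d_inv_aut:
  assumes "T \<in> graph_aut adj" "T x = v"
  shows "d (inv T x) x = d v x"
proof -
  have "T (inv T x) = x" using assms(1) by (simp add: graph_aut_def bij_is_surj surj_f_inv_f)
  then show ?thesis using d_aut[OF assms(1), of "inv T x" x] assms(2) d_commute by metis
qed

text \<open>
  The radialization depends only on the length of \<open>w\<close>, so the equation for a \<open>v\<close> with \<open>f v \<noteq> 0\<close> shows that
  \<open>f\<close> is radial.  Radiality is what allows to replace the centre \<open>inv (T v) x\<close> by \<open>v\<close>, and then the
  equation for vertices \<open>w\<close> of length \<open>2\<close> is the hypothesis of \<open>spherical_functionI\<close>.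
\<close>

lemma spherical_iff_functional_equation:
  assumes x: "x \<in> Vp" and T: "\<And>v. v \<in> Vp \<Longrightarrow> T v \<in> graph_aut adj \<and> T v x = v"
    and nz: "\<exists>v\<in>Vp. f v \<noteq> 0"
  shows "spherical_function adj Vp qp qm x f \<longleftrightarrow>
    (\<forall>v\<in>Vp. \<forall>w\<in>Vp. radialize adj x (translate (T v) f) w = f v * f w)"
    (is "?L \<longleftrightarrow> ?R")
proof
  assume ?L
  then obtain \<gamma> where g: "\<And>v. v \<in> Vp \<Longrightarrow> f v = sph \<gamma> (d v x)" using spherical_function_iff[OF x] by blast
  show ?R
  proof (intro ballI)
    fix v w assume v: "v \<in> Vp" and w: "w \<in> Vp"
    have dv: "d (inv (T v) x) x = d v x" using d_inv_aut T[OF v] by blast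
    then have "inv (T v) x \<in> Vp" using Vp_iff_even_d[OF x] v by simp
    moreover have "even (d w x)" using Vp_iff_even_d[OF x] w by simp
    ultimately have "sphere_sum (inv (T v) x) (d w x) f = of_nat (card (circle adj x (d w x))) * (f w * f v)"
      using sphere_sum_spherical[of "inv (T v) x" x "d w x" f \<gamma>] x g[OF w] g[OF v] g[of "inv (T v) x"] g dv
      by simp
    then show "radialize adj x (translate (T v) f) w = f v * f w"
      using radialize_translate[of "T v"] T[OF v] card_circle_pos[of x "d w x"] by simp
  qed
next
  assume ?R
  have R: "sphere_sum (inv (T v) x) (d w x) f = of_nat (card (circle adj x (d w x))) * (f v * f w)"
    if "v \<in> Vp" "w \<in> Vp" for v w
  proof -
    have "sphere_sum (inv (T v) x) (d w x) f / of_nat (card (circle adj x (d w x))) = f v * f w"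
      using \<open>?R\<close> that radialize_translate[of "T v"] T by metis
    then show ?thesis using card_circle_pos[of x "d w x"] by (simp add: field_simps)
  qed
  obtain z where z: "z \<in> Vp" "f z \<noteq> 0" using nz by blast
  have r: "radial_on adj x Vp f"
    unfolding radial_on_def
  proof (intro ballI impI)
    fix u v assume "u \<in> Vp" "v \<in> Vp" "d u x = d v x"
    then show "f u = f v" using R[OF z(1), of u] R[OF z(1), of v] z(2) card_circle_pos[of x "d v x"] by auto
  qed
  have inv: "inv (T v) x \<in> Vp" "f (inv (T v) x) = f v" "d (inv (T v) x) x = d v x" if "v \<in> Vp" for v
  proof -
    show dv: "d (inv (T v) x) x = d v x" using d_inv_aut T[OF that] by blast
    then show *: "inv (T v) x \<in> Vp" using Vp_iff_even_d[OF x] that by simp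
    then show "f (inv (T v) x) = f v" using r that dv unfolding radial_on_def by blast
  qed
  \<comment> \<open>The equation for \<open>v = z\<close> and \<open>w = x\<close>, where the sphere is a single point.\<close>
  have "f z = f z * f x" using R[OF z(1) x] inv(2)[OF z(1)] by (simp add: circle_0)
  then have 1: "f x = 1" using z(2) by simp
  obtain w where w: "d w x = 2" using circle_nonempty by blast
  then have wV: "w \<in> Vp" using Vp_iff_even_d[OF x] by simp
  show ?L
  proof (rule spherical_functionI[OF x r 1])
    fix y assume y: "y \<in> Vp"
    have "sphere_sum y 2 f = sphere_sum (inv (T y) x) 2 f"
      using radial_onD[OF radial_sphere_sum_Vp[OF x r, of 2] y inv(1)[OF y]] inv(3)[OF y] by simp
    then show "sphere_sum y 2 f = of_nat (card (circle adj x 2)) * f w * f y"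
      using R[OF y wV] w by simp
  qed
qed

end

section \<open>Growth of spherical functions\<close>

text \<open>
  Let \<open>\<alpha>\<close>, \<open>\<beta>\<close> with \<open>|\<beta>| \<le> |\<alpha>|\<close> be the characteristic roots; their product is \<open>1 / (P M)\<close>, so \<open>|\<beta>| \<le> 1/2\<close>.
  Since \<open>a (k + 1) - \<beta> * a k\<close> is a multiple of \<open>\<alpha> ^ k\<close>, the upper bound with \<open>A = max 1 |\<alpha>|\<close> follows
  by induction, also for a double root.  If \<open>|\<alpha>| > 1\<close>, then \<open>a k\<close> is a combination of \<open>\<alpha> ^ k\<close> and
  \<open>\<beta> ^ k\<close>, and for the lower bound the first term must dominate from \<open>k = 1\<close> on.  This comes from the
  way in which the coefficient of \<open>a (k + 1)\<close> depends on \<open>a 1\<close>: the coefficients of \<open>\<alpha> ^ k\<close> and \<open>\<beta> ^ k\<close>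
  factor, up to sign and a common constant, as \<open>(P \<alpha> + 1) (P M \<alpha> - 1) / \<alpha>\<close> and \<open>(P \<beta> + 1) (P M \<beta> - 1) / \<beta>\<close>.
\<close>

lemma recurrence_growth:
  fixes a :: "nat \<Rightarrow> complex" and P M :: real
  assumes P: "P \<ge> 2" and M: "M \<ge> 2" and a0: "a 0 = 1"
    and rec: "\<And>k. of_real (P * M) * a (Suc (Suc k))
                 = (of_real (M * (P + 1)) * a 1 + 1 - of_real M) * a (Suc k) - a k"
  obtains A B where "A \<ge> 1" "\<And>k. norm (a k) \<le> B * A ^ k"
    "A = 1 \<or> (\<exists>c>0. \<forall>k. c * A ^ k \<le> norm (a k))"
proof -
  define Q where "Q = P * M"
  have Q: "Q \<ge> 4" using mult_mono[OF P M] P by (simp add: Q_def)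
  define s where "s = of_real (M * (P + 1)) * a 1 + 1 - of_real M"
  define r where "r = csqrt (s\<^sup>2 - 4 * of_real Q)"
  have r: "r\<^sup>2 = s\<^sup>2 - 4 * of_real Q" by (simp add: r_def)
  have Q0: "of_real Q \<noteq> (0::complex)" using Q by simp
  obtain \<alpha> \<beta> :: complex where sum: "of_real Q * (\<alpha> + \<beta>) = s" and prod: "of_real Q * (\<alpha> * \<beta>) = 1"
    and le: "norm \<beta> \<le> norm \<alpha>"
  proof -
    define y z where "y = (s + r) / (2 * of_real Q)" and "z = (s - r) / (2 * of_real Q)"
    have 1: "of_real Q * (y + z) = s" using Q0 by (simp add: y_def z_def field_simps)
    have "of_real Q * (y * z) = (s\<^sup>2 - r\<^sup>2) / (4 * of_real Q)"
      using Q0 by (simp add: y_def z_def field_simps power2_eq_square)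
    then have 2: "of_real Q * (y * z) = 1" using Q0 by (simp add: r)
    show ?thesis using that[of y z] that[of z y] 1 2 by (metis add.commute linear mult.commute)
  qed
  have nprod: "Q * (norm \<alpha> * norm \<beta>) = 1"
    using arg_cong[OF prod, of norm] Q by (simp add: norm_mult)
  have beta: "norm \<beta> \<le> 1 / 2"
  proof (rule ccontr)
    assume "\<not> norm \<beta> \<le> 1 / 2"
    then have "1/2 < norm \<beta>" "1/2 < norm \<alpha>" using le by auto
    then have "1/2 * (1/2) < norm \<alpha> * norm \<beta>" by (intro mult_strict_mono) auto
    then have "4 * (1/4) < Q * (norm \<alpha> * norm \<beta>)" using Q by (intro mult_le_less_imp_less) auto
    then show False using nprod by simp
  qed
  have rec': "a (Suc (Suc k)) = (\<alpha> + \<beta>) * a (Suc k) - \<alpha> * \<beta> * a k" for k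
  proof -
    have "of_real Q * a (Suc (Suc k)) = s * a (Suc k) - 1 * a k"
      using rec[of k] unfolding s_def Q_def by simp
    also have "\<dots> = of_real Q * (\<alpha> + \<beta>) * a (Suc k) - of_real Q * (\<alpha> * \<beta>) * a k"
      by (simp only: sum prod)
    also have "\<dots> = of_real Q * ((\<alpha> + \<beta>) * a (Suc k) - \<alpha> * \<beta> * a k)" by (simp add: algebra_simps)
    finally show ?thesis using Q0 by simp
  qed
  \<comment> \<open>One factor of the difference operator is split off; the rest is a geometric sequence.\<close>
  have u: "a (Suc k) = \<beta> * a k + (a 1 - \<beta>) * \<alpha> ^ k" for k
  proof (induction k)
    case (Suc k)
    have "a (Suc (Suc k)) = \<beta> * a (Suc k) + \<alpha> * (a (Suc k) - \<beta> * a k)"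
      unfolding rec' by (simp add: algebra_simps)
    then show ?case using Suc by simp
  qed (simp add: a0)
  define A where "A = max 1 (norm \<alpha>)"
  define B where "B = 1 + 2 * norm (a 1 - \<beta>)"
  have A: "A \<ge> 1" by (simp add: A_def)
  have upper: "norm (a k) \<le> B * A ^ k" for k
  proof (induction k)
    case 0
    then show ?case by (simp add: a0 B_def)
  next
    case (Suc k)
    have "norm \<alpha> ^ k \<le> A ^ k" by (intro power_mono) (simp_all add: A_def)
    then have "norm ((a 1 - \<beta>) * \<alpha> ^ k) \<le> norm (a 1 - \<beta>) * A ^ k"
      unfolding norm_mult norm_power by (rule mult_left_mono) simp
    moreover have "norm (\<beta> * a k) \<le> 1/2 * (B * A ^ k)"
      unfolding norm_mult using beta Suc by (intro mult_mono) auto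
    ultimately have "norm (a (Suc k)) \<le> 1/2 * (B * A ^ k) + norm (a 1 - \<beta>) * A ^ k"
      unfolding u[of k] using norm_triangle_ineq[of "\<beta> * a k" "(a 1 - \<beta>) * \<alpha> ^ k"] by simp
    also have "\<dots> \<le> B * A ^ k" using A by (simp add: B_def algebra_simps)
    also have "\<dots> \<le> B * A ^ Suc k"
      using A by (intro mult_left_mono power_increasing) (auto simp: B_def)
    finally show ?case .
  qed
  have "A = 1 \<or> (\<exists>c>0. \<forall>k. c * A ^ k \<le> norm (a k))"
  proof (cases "norm \<alpha> \<le> 1")
    case True
    then show ?thesis by (simp add: A_def)
  next
    case False
    then have al: "norm \<alpha> > 1" "A = norm \<alpha>" by (auto simp: A_def)
    then have ne: "\<alpha> \<noteq> \<beta>" using beta by auto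
    have closed: "(\<alpha> - \<beta>) * a k = (a 1 - \<beta>) * \<alpha> ^ k - (a 1 - \<alpha>) * \<beta> ^ k" for k
    proof (induction k)
      case (Suc k)
      have "(\<alpha> - \<beta>) * a (Suc k) = \<beta> * ((\<alpha> - \<beta>) * a k) + (\<alpha> - \<beta>) * (a 1 - \<beta>) * \<alpha> ^ k"
        unfolding u[of k] by (simp add: algebra_simps)
      also have "\<dots> = (a 1 - \<beta>) * \<alpha> ^ Suc k - (a 1 - \<alpha>) * \<beta> ^ Suc k"
        unfolding Suc by (simp add: algebra_simps)
      finally show ?case .
    qed (simp add: a0)
    have a1: "(of_real Q + of_real M) * a 1 = of_real Q * (\<alpha> + \<beta>) + of_real M - 1"
      unfolding sum by (simp add: s_def Q_def algebra_simps)
    have factor: "(of_real Q + of_real M) * of_real P * ((a 1 - y) * x)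
        = (of_real P * x + 1) * (of_real Q * x - 1)"
      if "of_real Q * (x + y) = s" "of_real Q * (x * y) = 1" for x y :: complex
    proof -
      have "(of_real Q + of_real M) * of_real P * ((a 1 - y) * x)
          = of_real P * x * ((of_real Q + of_real M) * a 1) - of_real P * x * (of_real Q + of_real M) * y"
        by (simp add: algebra_simps)
      also have "\<dots> = of_real P * x * (of_real Q * (x + y) + of_real M - 1)
          - of_real P * x * (of_real Q + of_real M) * y"
        unfolding a1 that(1) sum ..
      also have "\<dots> = of_real P * of_real Q * x * x + of_real Q * x - of_real P * x - of_real Q * (x * y)"
        by (simp add: algebra_simps Q_def)
      also have "\<dots> = (of_real P * x + 1) * (of_real Q * x - 1)"
        unfolding that(2) by (simp add: algebra_simps)
      finally show ?thesis .
    qed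
    define K where "K = (Q + M) * P"
    have K: "K > 0" using P M Q by (simp add: K_def)
    have nfactor: "K * (norm (a 1 - y) * norm x) = norm (of_real P * x + 1) * norm (of_real Q * x - 1)"
      if "of_real Q * (x + y) = s" "of_real Q * (x * y) = 1" for x y :: complex
    proof -
      have "norm ((of_real Q + of_real M) * of_real P * ((a 1 - y) * x)) = K * (norm (a 1 - y) * norm x)"
        using K unfolding of_real_add[symmetric] of_real_mult[symmetric] K_def[symmetric] norm_mult
        by simp
      then show ?thesis unfolding factor[OF that] by (simp add: norm_mult)
    qed
    \<comment> \<open>The dominance of the first term at \<open>k = 1\<close>, freed of denominators.\<close>
    define \<delta> where "\<delta> = norm (a 1 - \<beta>) * norm \<alpha> - norm (a 1 - \<alpha>) * norm \<beta>"
    have "\<delta> > 0"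
    proof -
      have "norm \<beta> \<le> norm \<alpha> * norm \<beta>" using mult_right_mono[of 1 "norm \<alpha>" "norm \<beta>"] al(1) by simp
      then have Qb: "Q * norm \<beta> \<le> 1" using mult_left_mono[of _ _ Q] nprod Q by fastforce
      have "M * (P * norm \<beta>) \<le> 1" using Qb by (simp add: Q_def mult.assoc mult.left_commute)
      moreover have "2 * (P * norm \<beta>) \<le> M * (P * norm \<beta>)" using M P by (intro mult_right_mono) auto
      ultimately have Pb: "P * norm \<beta> \<le> 1/2" by simp
      \<comment> \<open>Both sides are compared with \<open>3\<close>, using \<open>P |\<beta>| \<le> 1/2\<close> and \<open>P M |\<beta>| \<le> 1\<close> for \<open>\<beta>\<close>,
        and \<open>P \<ge> 2\<close>, \<open>P M \<ge> 4\<close>, \<open>|\<alpha>| > 1\<close> for \<open>\<alpha>\<close>.\<close>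
      have "K * (norm (a 1 - \<alpha>) * norm \<beta>) = norm (of_real P * \<beta> + 1) * norm (of_real Q * \<beta> - 1)"
        by (rule nfactor) (use sum prod in \<open>simp_all add: add.commute mult.commute\<close>)
      also have "\<dots> \<le> (3/2) * 2"
      proof (intro mult_mono)
        show "norm (of_real P * \<beta> + 1) \<le> 3/2"
          using norm_triangle_ineq[of "of_real P * \<beta>" 1] Pb P by (simp add: norm_mult)
        show "norm (of_real Q * \<beta> - 1) \<le> 2"
          using norm_triangle_ineq4[of "of_real Q * \<beta>" 1] Qb Q by (simp add: norm_mult)
      qed auto
      also have "\<dots> < (2 * norm \<alpha> - 1) * (4 * norm \<alpha> - 1)"
      proof -
        have "1 * 3 < (2 * norm \<alpha> - 1) * (4 * norm \<alpha> - 1)"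
          using al(1) by (intro mult_strict_mono) auto
        then show ?thesis by simp
      qed
      also have "\<dots> \<le> (P * norm \<alpha> - 1) * (Q * norm \<alpha> - 1)"
        using P Q al(1) mult_right_mono[of 2 P "norm \<alpha>"] mult_right_mono[of 4 Q "norm \<alpha>"]
        by (intro mult_mono) auto
      also have "\<dots> \<le> norm (of_real P * \<alpha> + 1) * norm (of_real Q * \<alpha> - 1)"
      proof (intro mult_mono)
        show "P * norm \<alpha> - 1 \<le> norm (of_real P * \<alpha> + 1)"
          using norm_diff_ineq[of "of_real P * \<alpha>" 1] P by (simp add: norm_mult)
        show "Q * norm \<alpha> - 1 \<le> norm (of_real Q * \<alpha> - 1)"
          using norm_triangle_ineq2[of "of_real Q * \<alpha>" 1] Q by (simp add: norm_mult)
        show "0 \<le> Q * norm \<alpha> - 1" using Q al(1) mult_right_mono[of 4 Q "norm \<alpha>"] by simp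
      qed auto
      also have "\<dots> = K * (norm (a 1 - \<beta>) * norm \<alpha>)"
        by (rule nfactor[symmetric]) (use sum prod in simp_all)
      finally show ?thesis using K by (simp add: \<delta>_def)
    qed
    \<comment> \<open>The minimum with \<open>1\<close> covers \<open>k = 0\<close>, where the second term need not be smaller.\<close>
    define c where "c = min 1 (\<delta> / (norm \<alpha> * norm (\<alpha> - \<beta>)))"
    have npos: "norm \<alpha> > 0" "norm (\<alpha> - \<beta>) > 0" using al(1) ne by auto
    have "c * A ^ k \<le> norm (a k)" for k
    proof (cases k)
      case 0
      then show ?thesis by (simp add: a0 c_def)
    next
      case (Suc j)
      have "norm \<beta> ^ Suc j \<le> norm \<beta> * norm \<alpha> ^ j"
        using le by (auto intro!: mult_left_mono power_mono)
      then have "norm (a 1 - \<alpha>) * norm \<beta> ^ Suc j \<le> norm (a 1 - \<alpha>) * (norm \<beta> * norm \<alpha> ^ j)"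
        by (rule mult_left_mono) simp
      then have "\<delta> * norm \<alpha> ^ j \<le> norm (a 1 - \<beta>) * norm \<alpha> ^ Suc j - norm (a 1 - \<alpha>) * norm \<beta> ^ Suc j"
        by (simp add: \<delta>_def algebra_simps)
      also have "\<dots> \<le> norm ((\<alpha> - \<beta>) * a (Suc j))"
        unfolding closed using norm_triangle_ineq2 by (metis norm_mult norm_power)
      finally have *: "\<delta> * norm \<alpha> ^ j \<le> norm (\<alpha> - \<beta>) * norm (a k)" by (simp add: norm_mult Suc)
      have "c * A ^ k \<le> \<delta> / (norm \<alpha> * norm (\<alpha> - \<beta>)) * norm \<alpha> ^ Suc j"
        unfolding al(2) Suc by (rule mult_right_mono) (simp_all add: c_def)
      also have "\<dots> = \<delta> * norm \<alpha> ^ j / norm (\<alpha> - \<beta>)" using npos by (simp add: field_simps)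
      also have "\<dots> \<le> norm (a k)" using * npos by (simp add: divide_le_eq mult.commute)
      finally show ?thesis .
    qed
    moreover have "c > 0" using \<open>\<delta> > 0\<close> npos by (simp add: c_def)
    ultimately show ?thesis by blast
  qed
  then show ?thesis using that A upper by blast
qed

context semihomogeneous
begin

text \<open>
  Eliminating the odd values from three consecutive steps of the recurrence of \<open>sph\<close> leaves the
  recurrence of \<open>recurrence_growth\<close> for the even values.
\<close>

lemma sph_growth:
  obtains R B where "R \<ge> 1" "\<And>n. even n \<Longrightarrow> norm (sph \<gamma> n) \<le> B * R ^ n"
    "R = 1 \<or> (\<exists>c>0. \<forall>n. even n \<longrightarrow> c * R ^ n \<le> norm (sph \<gamma> n))"
proof -
  define a where "a k = sph \<gamma> (2 * k)" for k
  let ?P = "of_nat qp :: complex" and ?M = "of_nat qm :: complex"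
  have 0: "?P \<noteq> 0" "?M \<noteq> 0" using qp_gt_1 qm_gt_1 by auto
  have a1: "?M * a 1 = (?M + 1) * \<gamma> * \<gamma> - 1"
    using 0 by (simp add: a_def numeral_2_eq_2)
  have rec: "?P * ?M * a (Suc (Suc k)) = (?M * (?P + 1) * a 1 + 1 - ?M) * a (Suc k) - a k" for k
  proof -
    define n where "n = 2 * k"
    have n: "even n" "a k = sph \<gamma> n" "a (Suc k) = sph \<gamma> (Suc (Suc n))"
      "a (Suc (Suc k)) = sph \<gamma> (Suc (Suc (Suc (Suc n))))"
      by (simp_all add: a_def n_def)
    have e1: "?M * sph \<gamma> (Suc (Suc n)) = (?M + 1) * \<gamma> * sph \<gamma> (Suc n) - sph \<gamma> n"
      unfolding sph.simps(3)[of \<gamma> n] using n(1) 0 by (simp del: sph.simps add: add.commute)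
    have e2: "?P * sph \<gamma> (Suc (Suc (Suc n))) = (?P + 1) * \<gamma> * sph \<gamma> (Suc (Suc n)) - sph \<gamma> (Suc n)"
      unfolding sph.simps(3)[of \<gamma> "Suc n"] using n(1) 0 by (simp del: sph.simps add: add.commute)
    have e3: "?M * sph \<gamma> (Suc (Suc (Suc (Suc n)))) = (?M + 1) * \<gamma> * sph \<gamma> (Suc (Suc (Suc n))) - sph \<gamma> (Suc (Suc n))"
      unfolding sph.simps(3)[of \<gamma> "Suc (Suc n)"] using n(1) 0 by (simp del: sph.simps add: add.commute)
    have "?P * ?M * a (Suc (Suc k))
        = (?M + 1) * \<gamma> * (?P * sph \<gamma> (Suc (Suc (Suc n)))) - ?P * sph \<gamma> (Suc (Suc n))"
      unfolding n(4) mult.assoc e3 by (simp add: algebra_simps del: sph.simps)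
    also have "\<dots> = (?P + 1) * ((?M + 1) * \<gamma> * \<gamma>) * sph \<gamma> (Suc (Suc n))
        - ((?M + 1) * \<gamma> * sph \<gamma> (Suc n)) - ?P * sph \<gamma> (Suc (Suc n))"
      unfolding e2 by (simp add: algebra_simps del: sph.simps)
    also have "(?M + 1) * \<gamma> * sph \<gamma> (Suc n) = ?M * sph \<gamma> (Suc (Suc n)) + sph \<gamma> n" using e1 by simp
    also have "(?M + 1) * \<gamma> * \<gamma> = ?M * a 1 + 1" using a1 by simp
    finally show ?thesis unfolding n(2,3) by (simp add: algebra_simps del: sph.simps)
  qed
  obtain A B where AB: "A \<ge> 1" "\<And>k. norm (a k) \<le> B * A ^ k"
    "A = 1 \<or> (\<exists>c>0. \<forall>k. c * A ^ k \<le> norm (a k))"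
  proof (rule recurrence_growth[of "real qp" "real qm" a])
    show "complex_of_real (real qp * real qm) * a (Suc (Suc k)) =
      (complex_of_real (real qm * (real qp + 1)) * a 1 + 1 - complex_of_real (real qm)) * a (Suc k) - a k" for k
      using rec[of k] by simp
  qed (use qp_gt_1 qm_gt_1 in \<open>auto simp: a_def\<close>)
  have pow: "sqrt A ^ n = A ^ (n div 2)" "sph \<gamma> n = a (n div 2)" if "even n" for n
    using that AB(1) by (auto elim!: evenE simp: power_mult a_def)
  show ?thesis
  proof
    show "sqrt A \<ge> 1" using AB(1) by simp
    show "norm (sph \<gamma> n) \<le> B * sqrt A ^ n" if "even n" for n using AB(2) pow[OF that] by simp
    show "sqrt A = 1 \<or> (\<exists>c>0. \<forall>n. even n \<longrightarrow> c * sqrt A ^ n \<le> norm (sph \<gamma> n))"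
      using AB(3) pow by auto
  qed
qed

end

section \<open>Convolution and multiplicative functionals\<close>

lemma fibrewise_bij:
  fixes r s :: "'a \<Rightarrow> 'c"
  assumes fin: "\<And>c. finite {w. r w = c}" "\<And>c. finite {w. s w = c}"
    and card: "\<And>c. card {w. r w = c} = card {w. s w = c}"
  obtains H where "bij H" "\<And>w. s (H w) = r w"
proof -
  have "\<exists>h. bij_betw h {w. r w = c} {w. s w = c}" for c
    using finite_same_card_bij[OF fin(1) fin(2) card] .
  then obtain h where h: "\<And>c. bij_betw (h c) {w. r w = c} {w. s w = c}" by metis
  define H where "H w = h (r w) w" for w
  have sH: "s (H w) = r w" for w
    using bij_betwE[OF h[of "r w"]] by (simp add: H_def)
  have "inj H"
  proof (rule injI)
    fix u w assume eq: "H u = H w"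
    then have r: "r u = r w" using sH by metis
    have "h (r w) u = h (r w) w" using eq r by (simp add: H_def)
    then show "u = w" using inj_onD[OF bij_betw_imp_inj_on[OF h[of "r w"]], of u w] r by simp
  qed
  moreover have "surj H"
    unfolding surj_def
  proof
    fix y
    have "y \<in> h (s y) ` {w. r w = s y}" using bij_betw_imp_surj_on[OF h[of "s y"]] by simp
    then obtain x where "y = h (s y) x" "r x = s y" by blast
    then have "y = H x" unfolding H_def by metis
    then show "\<exists>x. y = H x" ..
  qed
  ultimately show ?thesis using that[of H] sH by (simp add: bij_def)
qed

locale rooted_tree = semihomogeneous adj Vp Vm qp qm
  for adj :: "'v \<Rightarrow> 'v \<Rightarrow> bool" and Vp Vm qp qm +
  fixes v0 :: 'v and \<tau> :: "'v \<Rightarrow> 'v \<Rightarrow> 'v"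
  assumes v0: "v0 \<in> Vp" and \<tau>: "v \<in> Vp \<Longrightarrow> \<tau> v \<in> graph_aut adj \<and> \<tau> v v0 = v"
begin

lemma bij_betw_\<tau>: "w \<in> Vp \<Longrightarrow> bij_betw (\<tau> w) Vp Vp"
  using bij_betw_aut_Vp[of "\<tau> w" v0] \<tau>[of w] v0 by simp

lemma \<tau>_Vp: "w \<in> Vp \<Longrightarrow> u \<in> Vp \<Longrightarrow> \<tau> w u \<in> Vp"
  using bij_betwE[OF bij_betw_\<tau>] by blast

lemma d_\<tau>: "w \<in> Vp \<Longrightarrow> d (\<tau> w u) w = d u v0"
  using d_aut[of "\<tau> w" u v0] \<tau>[of w] by simp

lemma radial_value_eq:
  assumes "radial_on adj v0 Vp f" "u \<in> Vp"
  shows "radial_value adj Vp v0 f (d u v0) = f u"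
  unfolding radial_value_def
proof (rule the_equality)
  show "\<forall>w\<in>Vp. d w v0 = d u v0 \<longrightarrow> f w = f u" using assms unfolding radial_on_def by blast
qed (use assms(2) in blast)

text \<open>
  The spheres of even radius partition \<open>V\<^sub>+\<close> into finite sets, and an absolutely convergent sum may be
  taken sphere by sphere.
\<close>

lemma infsum_spheres_zero:
  assumes h: "h abs_summable_on Vp" and z: "\<And>n. even n \<Longrightarrow> (\<Sum>u\<in>circle adj v0 n. h u) = (0::complex)"
  shows "infsum h Vp = 0"
proof -
  let ?S = "Sigma {n. even n} (circle adj v0)"
  have b: "bij_betw snd ?S Vp"
    unfolding bij_betw_def
  proof
    show "inj_on snd ?S" by (auto simp: inj_on_def circle_def)
    have "v \<in> snd ` ?S" if "v \<in> Vp" for v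
    proof (rule rev_image_eqI)
      show "(d v v0, v) \<in> ?S" using Vp_iff_even_d[OF v0, of v] that by (simp add: circle_def)
    qed simp
    then show "snd ` ?S = Vp" by (auto dest: subsetD[OF sphere_subset_Vp[OF v0]])
  qed
  have "h summable_on Vp" using h by (rule abs_summable_summable)
  then have s: "(\<lambda>x. h (snd x)) summable_on ?S" by (simp add: summable_on_reindex_bij_betw[OF b])
  have "infsum h Vp = infsum (\<lambda>x. h (snd x)) ?S" by (rule infsum_reindex_bij_betw[OF b, symmetric])
  also have "\<dots> = infsum (\<lambda>n. infsum h (circle adj v0 n)) {n. even n}"
    using infsum_Sigma_banach[OF s] by simp
  also have "\<dots> = 0" by (rule infsum_0) (simp add: z)
  finally show ?thesis .
qed

text \<open>
  For \<open>u\<close> and \<open>v\<close> of the same length there are equally many \<open>w\<close> with given distances to \<open>v0\<close> and to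
  \<open>u\<close>, respectively to \<open>v\<close>, because sums of a radial indicator function over spheres are radial.  Hence
  a permutation of the vertices carries one sum to the other term by term, regardless of
  convergence.
\<close>

lemma radial_convolution:
  assumes g: "radial_on adj v0 Vp g"
  shows "radial_on adj v0 Vp (convolution adj Vp v0 f g)"
  unfolding radial_on_def
proof (intro ballI impI)
  fix u v assume u: "u \<in> Vp" and v: "v \<in> Vp" and uv: "d u v0 = d v v0"
  define r where "r y w = (d w y, d w v0)" for y w
  have fib: "{w. r y w = (i, j)} = {w \<in> circle adj y i. d w v0 = j}" for y i j
    by (auto simp: r_def circle_def)
  have card: "card {w. r u w = (i, j)} = card {w. r v w = (i, j)}" for i j
  proof -
    let ?I = "\<lambda>w. if d w v0 = j then 1 else 0 :: complex"
    have "radial_on adj v0 UNIV ?I" unfolding radial_on_def by auto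
    then have "sphere_sum u i ?I = sphere_sum v i ?I"
      using radial_onD[OF radial_sphere_sum, of v0 ?I u v i] uv by blast
    then have "of_nat (card {w. r u w = (i, j)}) = (of_nat (card {w. r v w = (i, j)}) :: complex)"
      unfolding fib sphere_sum_def by (simp add: sum.If_cases Int_def)
    then show ?thesis by (simp only: of_nat_eq_iff)
  qed
  obtain H where H: "bij H" "\<And>w. r v (H w) = r u w"
  proof (rule fibrewise_bij[of "r u" "r v"])
    show "finite {w. r u w = c}" "finite {w. r v w = c}" for c by (cases c, simp add: fib)+
    show "card {w. r u w = c} = card {w. r v w = c}" for c using card by (cases c) simp
  qed blast
  have Hd: "d (H w) v = d w u" "d (H w) v0 = d w v0" for w using H(2)[of w] by (simp_all add: r_def)
  have HV: "H w \<in> Vp \<longleftrightarrow> w \<in> Vp" for w using Hd(2) Vp_iff_even_d[OF v0] by simp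
  have b: "bij_betw H Vp Vp"
  proof (rule bij_betw_subset[OF H(1)])
    show "H ` Vp = Vp"
    proof (intro equalityI subsetI)
      fix y assume "y \<in> Vp"
      moreover obtain w where "y = H w" using bij_is_surj[OF H(1)] by (metis surjD)
      ultimately show "y \<in> H ` Vp" using HV by blast
    qed (use HV in blast)
  qed simp
  have "convolution adj Vp v0 f g v = (\<Sum>\<^sub>\<infinity>w\<in>Vp. radial_value adj Vp v0 f (d v (H w)) * g (H w))"
    unfolding convolution_def by (rule infsum_reindex_bij_betw[OF b, symmetric])
  also have "\<dots> = convolution adj Vp v0 f g u"
    unfolding convolution_def
  proof (rule infsum_cong)
    fix w assume w: "w \<in> Vp"
    have "g (H w) = g w" using radial_onD[OF g] HV w Hd(2) by blast
    moreover have "d v (H w) = d u w" using Hd(1) d_commute by metis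
    ultimately show "radial_value adj Vp v0 f (d v (H w)) * g (H w) = radial_value adj Vp v0 f (d u w) * g w"
      by simp
  qed
  finally show "convolution adj Vp v0 f g u = convolution adj Vp v0 f g v" by simp
qed

definition wsummable :: "real \<Rightarrow> ('v \<Rightarrow> complex) \<Rightarrow> bool" where
  "wsummable R f \<longleftrightarrow> (\<lambda>v. norm (f v) * R ^ d v v0) summable_on Vp"

text \<open>
  Submultiplicativity of the weight: \<open>|\<tau>[w] u| \<le> |w| + |u|\<close>.
\<close>

lemma translated_bound:
  fixes f \<psi> :: "'v \<Rightarrow> complex"
  assumes R: "R \<ge> 1" and B: "B \<ge> 0" "\<forall>v\<in>Vp. norm (\<psi> v) \<le> B * R ^ d v v0"
    and w: "w \<in> Vp" and u: "u \<in> Vp"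
  shows "norm (f u * \<psi> (\<tau> w u)) \<le> B * R ^ d w v0 * (norm (f u) * R ^ d u v0)"
proof -
  have "d (\<tau> w u) v0 \<le> d w v0 + d u v0"
    using d_triangle[of "\<tau> w u" v0 w] d_\<tau>[OF w, of u] by simp
  then have "R ^ d (\<tau> w u) v0 \<le> R ^ (d w v0 + d u v0)" using R by (rule power_increasing)
  then have "norm (\<psi> (\<tau> w u)) \<le> B * R ^ (d w v0 + d u v0)"
    using B(2)[rule_format, OF \<tau>_Vp[OF w u]] mult_left_mono[OF _ B(1)] by fastforce
  then have "norm (f u) * norm (\<psi> (\<tau> w u)) \<le> norm (f u) * (B * R ^ (d w v0 + d u v0))"
    by (rule mult_left_mono) simp
  then show ?thesis by (simp add: norm_mult power_add mult_ac)
qed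

lemma translated_summable:
  fixes f \<psi> :: "'v \<Rightarrow> complex"
  assumes f: "wsummable R f" and R: "R \<ge> 1" and B: "B \<ge> 0" "\<forall>v\<in>Vp. norm (\<psi> v) \<le> B * R ^ d v v0"
    and w: "w \<in> Vp"
  shows "(\<lambda>u. f u * \<psi> (\<tau> w u)) abs_summable_on Vp"
    and "(\<Sum>\<^sub>\<infinity>u\<in>Vp. norm (f u * \<psi> (\<tau> w u)))
      \<le> B * R ^ d w v0 * (\<Sum>\<^sub>\<infinity>u\<in>Vp. norm (f u) * R ^ d u v0)"
proof -
  have s: "(\<lambda>u. B * R ^ d w v0 * (norm (f u) * R ^ d u v0)) summable_on Vp"
    using f unfolding wsummable_def by (rule summable_on_cmult_right)
  show a: "(\<lambda>u. f u * \<psi> (\<tau> w u)) abs_summable_on Vp"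
    by (rule abs_summable_on_comparison_test'[OF s translated_bound[OF R B w, of _ f]])
  have "(\<Sum>\<^sub>\<infinity>u\<in>Vp. norm (f u * \<psi> (\<tau> w u))) \<le> (\<Sum>\<^sub>\<infinity>u\<in>Vp. B * R ^ d w v0 * (norm (f u) * R ^ d u v0))"
    by (rule infsum_mono[OF a s translated_bound[OF R B w, of _ f]])
  then show "(\<Sum>\<^sub>\<infinity>u\<in>Vp. norm (f u * \<psi> (\<tau> w u)))
      \<le> B * R ^ d w v0 * (\<Sum>\<^sub>\<infinity>u\<in>Vp. norm (f u) * R ^ d u v0)"
    by (simp add: infsum_cmult_right')
qed

lemma radial_value_\<tau>:
  "radial_on adj v0 Vp f \<Longrightarrow> w \<in> Vp \<Longrightarrow> u \<in> Vp \<Longrightarrow> radial_value adj Vp v0 f (d (\<tau> w u) w) = f u"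
  using radial_value_eq[of f u] d_\<tau>[of w u] by simp

text \<open>
  The substitution \<open>v = \<tau> w u\<close> turns \<open>d v w\<close> into the length of \<open>u\<close>, so that the double series is
  dominated by the product of the weighted norms of \<open>f\<close> and \<open>g\<close>.
\<close>

lemma convolution_kernel_summable:
  fixes f g \<psi> :: "'v \<Rightarrow> complex"
  assumes rf: "radial_on adj v0 Vp f" and f: "wsummable R f" and g: "wsummable R g"
    and R: "R \<ge> 1" and B: "B \<ge> 0" "\<forall>v\<in>Vp. norm (\<psi> v) \<le> B * R ^ d v v0"
  shows "(\<lambda>(w, v). radial_value adj Vp v0 f (d v w) * g w * \<psi> v) abs_summable_on (Vp \<times> Vp)"
proof -
  let ?F = "radial_value adj Vp v0 f"
  let ?N = "\<Sum>\<^sub>\<infinity>u\<in>Vp. norm (f u) * R ^ d u v0"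
  have slice: "(\<lambda>u. norm (?F (d (\<tau> w u) w) * g w * \<psi> (\<tau> w u))) summable_on Vp
     \<and> (\<Sum>\<^sub>\<infinity>u\<in>Vp. norm (?F (d (\<tau> w u) w) * g w * \<psi> (\<tau> w u))) \<le> B * ?N * (norm (g w) * R ^ d w v0)"
    if w: "w \<in> Vp" for w
  proof -
    have eq: "norm (?F (d (\<tau> w u) w) * g w * \<psi> (\<tau> w u)) = norm (g w) * norm (f u * \<psi> (\<tau> w u))"
      if "u \<in> Vp" for u
      by (simp add: radial_value_\<tau>[OF rf w that] norm_mult mult_ac)
    note t = translated_summable[OF f R B w]
    have "(\<lambda>u. norm (g w) * norm (f u * \<psi> (\<tau> w u))) summable_on Vp"
      by (rule summable_on_cmult_right[OF t(1)])
    moreover have "(\<lambda>u. norm (?F (d (\<tau> w u) w) * g w * \<psi> (\<tau> w u))) summable_on Vp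
        \<longleftrightarrow> (\<lambda>u. norm (g w) * norm (f u * \<psi> (\<tau> w u))) summable_on Vp"
      by (rule summable_on_cong) (rule eq)
    ultimately have s: "(\<lambda>u. norm (?F (d (\<tau> w u) w) * g w * \<psi> (\<tau> w u))) summable_on Vp" by blast
    have "(\<Sum>\<^sub>\<infinity>u\<in>Vp. norm (?F (d (\<tau> w u) w) * g w * \<psi> (\<tau> w u)))
        = (\<Sum>\<^sub>\<infinity>u\<in>Vp. norm (g w) * norm (f u * \<psi> (\<tau> w u)))"
      by (rule infsum_cong) (rule eq)
    also have "\<dots> = norm (g w) * (\<Sum>\<^sub>\<infinity>u\<in>Vp. norm (f u * \<psi> (\<tau> w u)))"
      by (rule infsum_cmult_right')
    also have "\<dots> \<le> norm (g w) * (B * R ^ d w v0 * ?N)"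
      by (rule mult_left_mono[OF t(2)]) simp
    also have "\<dots> = B * ?N * (norm (g w) * R ^ d w v0)"
      by simp
    finally show ?thesis using s by blast
  qed
  show ?thesis
    unfolding abs_summable_on_Sigma_iff
  proof (intro conjI ballI)
    fix w assume w: "w \<in> Vp"
    show "(\<lambda>v. case (w, v) of (w, v) \<Rightarrow> ?F (d v w) * g w * \<psi> v) abs_summable_on Vp"
      using slice[OF w]
        summable_on_reindex_bij_betw[OF bij_betw_\<tau>[OF w], of "\<lambda>v. norm (?F (d v w) * g w * \<psi> v)"] by simp
  next
    have s: "(\<lambda>w. B * ?N * (norm (g w) * R ^ d w v0)) summable_on Vp"
      using g unfolding wsummable_def by (rule summable_on_cmult_right)
    show "(\<lambda>w. \<Sum>\<^sub>\<infinity>v\<in>Vp. norm (case (w, v) of (w, v) \<Rightarrow> ?F (d v w) * g w * \<psi> v)) abs_summable_on Vp"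
    proof (rule abs_summable_on_comparison_test'[OF s])
      fix w assume w: "w \<in> Vp"
      have "0 \<le> (\<Sum>\<^sub>\<infinity>v\<in>Vp. norm (?F (d v w) * g w * \<psi> v))" by (rule infsum_nonneg) simp
      moreover have "(\<Sum>\<^sub>\<infinity>v\<in>Vp. norm (?F (d v w) * g w * \<psi> v)) \<le> B * ?N * (norm (g w) * R ^ d w v0)"
        using slice[OF w]
          infsum_reindex_bij_betw[OF bij_betw_\<tau>[OF w], of "\<lambda>v. norm (?F (d v w) * g w * \<psi> v)"] by simp
      ultimately show "norm (\<Sum>\<^sub>\<infinity>v\<in>Vp. norm (case (w, v) of (w, v) \<Rightarrow> ?F (d v w) * g w * \<psi> v))
          \<le> B * ?N * (norm (g w) * R ^ d w v0)" by simp
    qed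
  qed
qed

text \<open>
  With \<open>\<psi> = 1\<close> this says that the convolution is in \<open>\<ell>\<^sup>1\<close>, with \<open>\<psi> = \<phi>\<close> that it pairs with \<open>\<phi>\<close>.
\<close>

lemma convolution_summable:
  fixes f g \<psi> :: "'v \<Rightarrow> complex"
  assumes "radial_on adj v0 Vp f" and "wsummable R f" and "wsummable R g"
    and "R \<ge> 1" and "B \<ge> 0" "\<forall>v\<in>Vp. norm (\<psi> v) \<le> B * R ^ d v v0"
  shows "(\<lambda>v. convolution adj Vp v0 f g v * \<psi> v) abs_summable_on Vp"
proof -
  let ?K = "\<lambda>v w. radial_value adj Vp v0 f (d v w) * g w * \<psi> v"
  have "(\<lambda>(w, v). norm (?K v w)) summable_on Vp \<times> Vp"
    using convolution_kernel_summable[OF assms] by (simp add: case_prod_unfold)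
  then have K: "(\<lambda>(v, w). ?K v w) abs_summable_on Vp \<times> Vp"
    by (subst summable_on_swap) (simp add: case_prod_unfold)
  then have slice: "(\<lambda>w. ?K v w) abs_summable_on Vp" if "v \<in> Vp" for v
    using that unfolding abs_summable_on_Sigma_iff by simp
  have s: "(\<lambda>v. \<Sum>\<^sub>\<infinity>w\<in>Vp. norm (?K v w)) summable_on Vp"
    using abs_summable_summable[OF conjunct2[OF K[unfolded abs_summable_on_Sigma_iff]]] by simp
  show ?thesis
  proof (rule abs_summable_on_comparison_test'[OF s])
    fix v assume v: "v \<in> Vp"
    have "convolution adj Vp v0 f g v * \<psi> v = (\<Sum>\<^sub>\<infinity>w\<in>Vp. ?K v w)"
      by (simp add: convolution_def infsum_cmult_left')
    then show "norm (convolution adj Vp v0 f g v * \<psi> v) \<le> (\<Sum>\<^sub>\<infinity>w\<in>Vp. norm (?K v w))"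
      using norm_infsum_bound[OF slice[OF v]] by simp
  qed
qed

text \<open>
  On each sphere \<open>f\<close> is constant and the sum of \<open>u \<mapsto> \<phi> (\<tau> w u)\<close> is that of \<open>\<phi> w * \<phi>\<close> by the mean value
  property, so the sums \<open>\<Sum> f u * \<phi> (\<tau> w u)\<close> and \<open>\<phi> w * (\<Sum> f u * \<phi> u)\<close> agree sphere by sphere.
\<close>

lemma spherical_eigen_convolution:
  assumes rf: "radial_on adj v0 Vp f" and f: "wsummable R f"
    and R: "R \<ge> 1" and B: "B \<ge> 0" "\<forall>v\<in>Vp. norm (\<phi> v) \<le> B * R ^ d v v0"
    and \<phi>: "\<And>v. v \<in> Vp \<Longrightarrow> \<phi> v = sph \<gamma> (d v v0)" and w: "w \<in> Vp"
  shows "(\<Sum>\<^sub>\<infinity>v\<in>Vp. radial_value adj Vp v0 f (d v w) * \<phi> v) = \<phi> w * pairing Vp f \<phi>"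
proof -
  let ?F = "radial_value adj Vp v0 f"
  have "(\<Sum>\<^sub>\<infinity>v\<in>Vp. ?F (d v w) * \<phi> v) = (\<Sum>\<^sub>\<infinity>u\<in>Vp. ?F (d (\<tau> w u) w) * \<phi> (\<tau> w u))"
    by (rule infsum_reindex_bij_betw[OF bij_betw_\<tau>[OF w], symmetric])
  also have "\<dots> = (\<Sum>\<^sub>\<infinity>u\<in>Vp. f u * \<phi> (\<tau> w u))"
    using radial_value_\<tau>[OF rf w] by (intro infsum_cong) simp
  finally have 1: "(\<Sum>\<^sub>\<infinity>v\<in>Vp. ?F (d v w) * \<phi> v) = (\<Sum>\<^sub>\<infinity>u\<in>Vp. f u * \<phi> (\<tau> w u))" .
  have s1: "(\<lambda>u. f u * \<phi> (\<tau> w u)) abs_summable_on Vp"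
    by (rule translated_summable(1)[OF f R B w])
  have "(\<lambda>u. f u * \<phi> u) abs_summable_on Vp"
  proof (rule abs_summable_on_comparison_test')
    show "(\<lambda>u. B * (norm (f u) * R ^ d u v0)) summable_on Vp"
      using f unfolding wsummable_def by (rule summable_on_cmult_right)
    show "norm (f u * \<phi> u) \<le> B * (norm (f u) * R ^ d u v0)" if "u \<in> Vp" for u
      using mult_left_mono[OF B(2)[rule_format, OF that], of "norm (f u)"] by (simp add: norm_mult mult_ac)
  qed
  then have s2: "(\<lambda>u. \<phi> w * (f u * \<phi> u)) abs_summable_on Vp"
    unfolding norm_mult[of "\<phi> w"] by (rule summable_on_cmult_right)
  have s3: "(\<lambda>u. f u * \<phi> (\<tau> w u) - \<phi> w * (f u * \<phi> u)) abs_summable_on Vp"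
    by (rule abs_summable_on_comparison_test'[OF summable_on_add[OF s1 s2]])
       (rule norm_triangle_ineq4)
  have "(\<Sum>\<^sub>\<infinity>u\<in>Vp. f u * \<phi> (\<tau> w u) - \<phi> w * (f u * \<phi> u)) = 0"
  proof (rule infsum_spheres_zero[OF s3])
    fix n :: nat assume n: "even n"
    obtain z where z: "z \<in> circle adj v0 n" using circle_not_empty by blast
    have V: "circle adj v0 n \<subseteq> Vp" by (rule sphere_subset_Vp[OF v0 n])
    have fz: "f u = f z" if "u \<in> circle adj v0 n" for u
      using radial_onD[OF rf, of u z] that z V by (auto simp: circle_def)
    have \<phi>0: "\<phi> v0 = 1" using \<phi>[OF v0] by simp
    have "(\<Sum>u\<in>circle adj v0 n. \<phi> (\<tau> w u)) = sphere_sum w n \<phi>"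
      unfolding sphere_sum_def
      using sum.reindex_bij_betw[OF bij_betw_aut_circle[of "\<tau> w" v0 n], of \<phi>] \<tau>[OF w] by simp
    also have "\<dots> = \<phi> w * sphere_sum v0 n \<phi>"
      using sphere_sum_spherical[OF w v0 n \<phi>] sphere_sum_spherical[OF v0 v0 n \<phi>] \<phi>0
      by (simp only: mult_ac mult_1)
    finally have "(\<Sum>u\<in>circle adj v0 n. \<phi> (\<tau> w u)) = \<phi> w * sphere_sum v0 n \<phi>" .
    moreover have "(\<Sum>u\<in>circle adj v0 n. f u * \<phi> (\<tau> w u) - \<phi> w * (f u * \<phi> u))
       = f z * ((\<Sum>u\<in>circle adj v0 n. \<phi> (\<tau> w u)) - \<phi> w * sphere_sum v0 n \<phi>)"
      unfolding sphere_sum_def sum_distrib_left sum_subtractf[symmetric]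
      using fz by (intro sum.cong refl) (simp add: algebra_simps)
    ultimately show "(\<Sum>u\<in>circle adj v0 n. f u * \<phi> (\<tau> w u) - \<phi> w * (f u * \<phi> u)) = 0" by simp
  qed
  then have "(\<Sum>\<^sub>\<infinity>u\<in>Vp. f u * \<phi> (\<tau> w u)) = (\<Sum>\<^sub>\<infinity>u\<in>Vp. \<phi> w * (f u * \<phi> u))"
    using infsum_add[OF abs_summable_summable[OF s3] abs_summable_summable[OF s2]] by simp
  then show ?thesis unfolding 1 pairing_def by (simp add: infsum_cmult_right')
qed

text \<open>
  The growth dichotomy places the domain of the functional inside a weighted \<open>\<ell>\<^sup>1\<close> space whose weight
  dominates \<open>\<phi>\<close>; there the two sums over \<open>v\<close> and \<open>w\<close> may be exchanged.
\<close>

lemma spherical_imp_multiplicative: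
  assumes "spherical_function adj Vp qp qm v0 \<phi>"
  shows "multiplicative_functional adj Vp v0 \<phi>"
proof -
  obtain \<gamma> where \<phi>: "\<And>v. v \<in> Vp \<Longrightarrow> \<phi> v = sph \<gamma> (d v v0)"
    using assms spherical_function_iff[OF v0] by blast
  obtain R B where R: "R \<ge> 1" and upper: "\<And>n. even n \<Longrightarrow> norm (sph \<gamma> n) \<le> B * R ^ n"
    and lower: "R = 1 \<or> (\<exists>c>0. \<forall>n. even n \<longrightarrow> c * R ^ n \<le> norm (sph \<gamma> n))"
    by (rule sph_growth[of \<gamma>]) blast
  have even: "even (d v v0)" if "v \<in> Vp" for v using Vp_iff_even_d[OF v0] that by blast
  have B: "\<forall>v\<in>Vp. norm (\<phi> v) \<le> B * R ^ d v v0"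
    using upper[OF even] \<phi> by simp
  have B0: "B \<ge> 0" using upper[of 0] by simp
  have dom: "radial_on adj v0 Vp f \<and> wsummable R f" if f: "f \<in> pairing_domain adj Vp v0 \<phi>" for f
  proof
    show "radial_on adj v0 Vp f" using f by (simp add: pairing_domain_def ell1_radial_def)
    have s: "f abs_summable_on Vp" "(\<lambda>v. f v * \<phi> v) abs_summable_on Vp"
      using f by (simp_all add: pairing_domain_def ell1_radial_def)
    from lower show "wsummable R f"
    proof
      assume "R = 1"
      then show ?thesis using s(1) by (simp add: wsummable_def)
    next
      assume "\<exists>c>0. \<forall>n. even n \<longrightarrow> c * R ^ n \<le> norm (sph \<gamma> n)"
      then obtain c where c: "c > 0" "\<And>n. even n \<Longrightarrow> c * R ^ n \<le> norm (sph \<gamma> n)" by blast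
      have "(\<lambda>v. norm (norm (f v) * R ^ d v v0)) summable_on Vp"
      proof (rule abs_summable_on_comparison_test')
        show "(\<lambda>v. 1 / c * norm (f v * \<phi> v)) summable_on Vp" using s(2) by (rule summable_on_cmult_right)
        fix v assume v: "v \<in> Vp"
        have "R ^ d v v0 \<le> 1 / c * norm (\<phi> v)"
          using c(1) c(2)[OF even[OF v]] \<phi>[OF v] by (simp add: field_simps)
        then show "norm (norm (f v) * R ^ d v v0) \<le> 1 / c * norm (f v * \<phi> v)"
          using mult_left_mono[of "R ^ d v v0" "1 / c * norm (\<phi> v)" "norm (f v)"] R
          by (simp add: norm_mult mult_ac)
      qed
      then show ?thesis using R by (simp add: wsummable_def)
    qed
  qed
  show ?thesis
    unfolding multiplicative_functional_def
  proof (intro ballI conjI)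
    fix f g assume f: "f \<in> pairing_domain adj Vp v0 \<phi>" and g: "g \<in> pairing_domain adj Vp v0 \<phi>"
    note rf = conjunct1[OF dom[OF f]] and wf = conjunct2[OF dom[OF f]]
      and rg = conjunct1[OF dom[OF g]] and wg = conjunct2[OF dom[OF g]]
    let ?F = "radial_value adj Vp v0 f"
    have "(\<lambda>v. convolution adj Vp v0 f g v * 1) abs_summable_on Vp"
      by (rule convolution_summable[OF rf wf wg R zero_le_one]) (simp add: R)
    moreover have "(\<lambda>v. convolution adj Vp v0 f g v * \<phi> v) abs_summable_on Vp"
      by (rule convolution_summable[OF rf wf wg R B0 B])
    ultimately show "convolution adj Vp v0 f g \<in> pairing_domain adj Vp v0 \<phi>"
      using radial_convolution[OF rg] by (simp add: pairing_domain_def ell1_radial_def)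
    have K: "(\<lambda>(w, v). ?F (d v w) * g w * \<phi> v) summable_on (Vp \<times> Vp)"
      by (rule abs_summable_summable[OF convolution_kernel_summable[OF rf wf wg R B0 B]])
    have "pairing Vp (convolution adj Vp v0 f g) \<phi> = (\<Sum>\<^sub>\<infinity>v\<in>Vp. \<Sum>\<^sub>\<infinity>w\<in>Vp. ?F (d v w) * g w * \<phi> v)"
      by (simp add: pairing_def convolution_def infsum_cmult_left')
    also have "\<dots> = (\<Sum>\<^sub>\<infinity>w\<in>Vp. \<Sum>\<^sub>\<infinity>v\<in>Vp. ?F (d v w) * g w * \<phi> v)"
      by (rule infsum_swap_banach[OF K, symmetric])
    also have "\<dots> = (\<Sum>\<^sub>\<infinity>w\<in>Vp. pairing Vp f \<phi> * (g w * \<phi> w))"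
    proof (rule infsum_cong)
      fix w assume w: "w \<in> Vp"
      have E: "(\<Sum>\<^sub>\<infinity>v\<in>Vp. ?F (d v w) * \<phi> v) = \<phi> w * pairing Vp f \<phi>"
        by (rule spherical_eigen_convolution[OF rf wf R B0 B _ w]) (rule \<phi>)
      have "(\<Sum>\<^sub>\<infinity>v\<in>Vp. ?F (d v w) * g w * \<phi> v) = (\<Sum>\<^sub>\<infinity>v\<in>Vp. g w * (?F (d v w) * \<phi> v))"
        by (simp add: mult_ac)
      also have "\<dots> = g w * (\<phi> w * pairing Vp f \<phi>)"
        unfolding infsum_cmult_right' E ..
      finally show "(\<Sum>\<^sub>\<infinity>v\<in>Vp. ?F (d v w) * g w * \<phi> v) = pairing Vp f \<phi> * (g w * \<phi> w)" by simp
    qed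
    also have "\<dots> = pairing Vp f \<phi> * pairing Vp g \<phi>" by (simp add: infsum_cmult_right' pairing_def)
    finally show "pairing Vp (convolution adj Vp v0 f g) \<phi> = pairing Vp f \<phi> * pairing Vp g \<phi>" .
  qed
qed

definition circle_ind :: "nat \<Rightarrow> 'v \<Rightarrow> complex" where
  "circle_ind n v = of_bool (d v v0 = n)"

lemma infsum_finite_support:
  assumes "finite S" "S \<subseteq> A" "\<And>v. v \<in> A - S \<Longrightarrow> h v = (0::complex)"
  shows "infsum h A = sum h S"
proof -
  have "infsum h A = infsum h S" by (rule infsum_cong_neutral) (use assms in auto)
  then show ?thesis using assms(1) by simp
qed

lemma circle_ind_in_pairing_domain:
  assumes "even n"
  shows "circle_ind n \<in> pairing_domain adj Vp v0 \<phi>"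
proof -
  have "(\<lambda>v. circle_ind n v * h v) abs_summable_on Vp" for h
  proof -
    have "(\<lambda>v. norm (circle_ind n v * h v)) summable_on circle adj v0 n" by (rule summable_on_finite) simp
    moreover have "(\<lambda>v. norm (circle_ind n v * h v)) summable_on circle adj v0 n \<longleftrightarrow>
        (\<lambda>v. norm (circle_ind n v * h v)) summable_on Vp"
      by (rule summable_on_cong_neutral)
         (use sphere_subset_Vp[OF v0 assms] in \<open>auto simp: circle_def circle_ind_def\<close>)
    ultimately show ?thesis by blast
  qed
  from this[of "\<lambda>_. 1"] this[of \<phi>] show ?thesis
    by (simp add: pairing_domain_def ell1_radial_def radial_on_def circle_ind_def)
qed

lemma pairing_circle_ind: "even n \<Longrightarrow> pairing Vp (circle_ind n) \<phi> = sphere_sum v0 n \<phi>"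
  unfolding pairing_def sphere_sum_def
  by (subst infsum_finite_support[OF finite_circle[of v0 n]])
     (use sphere_subset_Vp[OF v0] in \<open>auto simp: circle_def circle_ind_def\<close>)

lemma pairing_convolution_circle_ind:
  assumes i: "even i" and j: "even j"
  shows "pairing Vp (convolution adj Vp v0 (circle_ind i) (circle_ind j)) \<phi> = (\<Sum>w\<in>circle adj v0 j. sphere_sum w i \<phi>)"
proof -
  let ?C = "circle adj v0 j"
  define U where "U = (\<Union>w\<in>?C. circle adj w i)"
  have CV: "?C \<subseteq> Vp" by (rule sphere_subset_Vp[OF v0 j])
  have U: "finite U" "U \<subseteq> Vp" using sphere_subset_Vp[OF _ i] CV by (auto simp: U_def)
  have rv: "radial_value adj Vp v0 (circle_ind i) (d v w) = of_bool (d v w = i)" if "v \<in> Vp" "w \<in> Vp" for v w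
  proof -
    obtain u where u: "d u v0 = d v w" using circle_nonempty by blast
    then have "u \<in> Vp" using Vp_iff_even_d[OF v0, of u] Vp_iff_even_d[OF that(2), of v] that(1) by simp
    moreover have "radial_on adj v0 Vp (circle_ind i)" by (simp add: radial_on_def circle_ind_def)
    ultimately show ?thesis using radial_value_eq[of "circle_ind i" u] u by (simp add: circle_ind_def)
  qed
  have conv: "convolution adj Vp v0 (circle_ind i) (circle_ind j) v = (\<Sum>w\<in>?C. of_bool (d v w = i))" if v: "v \<in> Vp" for v
  proof -
    have "convolution adj Vp v0 (circle_ind i) (circle_ind j) v = (\<Sum>\<^sub>\<infinity>w\<in>Vp. of_bool (d v w = i) * circle_ind j w)"
      unfolding convolution_def using rv[OF v] by (intro infsum_cong) simp
    also have "\<dots> = (\<Sum>w\<in>?C. of_bool (d v w = i) * circle_ind j w)"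
      by (rule infsum_finite_support[OF finite_circle CV]) (use CV in \<open>auto simp: circle_def circle_ind_def\<close>)
    also have "\<dots> = (\<Sum>w\<in>?C. of_bool (d v w = i))"
      by (intro sum.cong) (auto simp: circle_def circle_ind_def)
    finally show ?thesis .
  qed
  have "pairing Vp (convolution adj Vp v0 (circle_ind i) (circle_ind j)) \<phi>
      = (\<Sum>\<^sub>\<infinity>v\<in>Vp. (\<Sum>w\<in>?C. of_bool (d v w = i)) * \<phi> v)"
    unfolding pairing_def using conv by (intro infsum_cong) simp
  also have "\<dots> = (\<Sum>v\<in>U. (\<Sum>w\<in>?C. of_bool (d v w = i)) * \<phi> v)"
  proof (rule infsum_finite_support[OF U])
    fix v assume "v \<in> Vp - U"
    then have "(\<Sum>w\<in>?C. of_bool (d v w = i)) = (0::complex)"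
      by (intro sum.neutral) (auto simp: U_def circle_def)
    then show "(\<Sum>w\<in>?C. of_bool (d v w = i)) * \<phi> v = 0" by simp
  qed
  also have "\<dots> = (\<Sum>w\<in>?C. \<Sum>v\<in>U. of_bool (d v w = i) * \<phi> v)"
    unfolding sum_distrib_right by (rule sum.swap)
  also have "\<dots> = (\<Sum>w\<in>?C. sphere_sum w i \<phi>)"
  proof (rule sum.cong[OF refl])
    fix w assume w: "w \<in> ?C"
    have "(\<Sum>v\<in>U. of_bool (d v w = i) * \<phi> v) = (\<Sum>v\<in>circle adj w i. of_bool (d v w = i) * \<phi> v)"
      by (rule sum.mono_neutral_right) (use U w in \<open>auto simp: U_def circle_def\<close>)
    also have "\<dots> = sphere_sum w i \<phi>"
      unfolding sphere_sum_def by (intro sum.cong) (auto simp: circle_def)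
    finally show "(\<Sum>v\<in>U. of_bool (d v w = i) * \<phi> v) = sphere_sum w i \<phi>" .
  qed
  finally show ?thesis .
qed

text \<open>
  Testing with the indicator functions of the spheres of radius \<open>i\<close> and \<open>d w v0\<close>, and using that all
  functions involved are radial, gives \<open>sphere_sum w i \<phi> = sphere_sum v0 i \<phi> * \<phi> w\<close>.  The radius \<open>i = 0\<close>
  yields \<open>\<phi> v0 = 1\<close>, and \<open>i = 2\<close> is the hypothesis of \<open>spherical_functionI\<close>.
\<close>

lemma multiplicative_imp_spherical:
  assumes r: "radial_on adj v0 Vp \<phi>" and nz: "z \<in> Vp" "\<phi> z \<noteq> 0"
    and m: "multiplicative_functional adj Vp v0 \<phi>"
  shows "spherical_function adj Vp qp qm v0 \<phi>"
proof -
  have sphere: "sphere_sum v0 (d w v0) h = of_nat (card (circle adj v0 (d w v0))) * h w"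
    if "w \<in> Vp" "radial_on adj v0 Vp h" for w h
  proof -
    have "circle adj v0 (d w v0) \<subseteq> Vp"
      using sphere_subset_Vp[OF v0] Vp_iff_even_d[OF v0] that(1) by blast
    then have "sphere_sum v0 (d w v0) h = (\<Sum>u\<in>circle adj v0 (d w v0). h w)"
      unfolding sphere_sum_def using radial_onD[OF that(2) _ that(1)] by (intro sum.cong) (auto simp: circle_def)
    then show ?thesis by simp
  qed
  have m: "sphere_sum v0 (d w v0) (\<lambda>w. sphere_sum w i \<phi>) = sphere_sum v0 i \<phi> * sphere_sum v0 (d w v0) \<phi>"
    if i: "even i" and w: "w \<in> Vp" for i w
  proof -
    have j: "even (d w v0)" using Vp_iff_even_d[OF v0] w by blast
    have "pairing Vp (convolution adj Vp v0 (circle_ind i) (circle_ind (d w v0))) \<phi>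
        = pairing Vp (circle_ind i) \<phi> * pairing Vp (circle_ind (d w v0)) \<phi>"
      using m circle_ind_in_pairing_domain[OF i] circle_ind_in_pairing_domain[OF j]
      unfolding multiplicative_functional_def by blast
    then show ?thesis
      unfolding pairing_convolution_circle_ind[OF i j] pairing_circle_ind[OF i] pairing_circle_ind[OF j]
      by (simp add: sphere_sum_def)
  qed
  have e: "sphere_sum w i \<phi> = sphere_sum v0 i \<phi> * \<phi> w" if i: "even i" and w: "w \<in> Vp" for i w
  proof -
    have "of_nat (card (circle adj v0 (d w v0))) * sphere_sum w i \<phi>
        = of_nat (card (circle adj v0 (d w v0))) * (sphere_sum v0 i \<phi> * \<phi> w)"
      using m[OF i w] sphere[OF w r] sphere[OF w radial_sphere_sum_Vp[OF v0 r i]] by simp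
    then show ?thesis using card_circle_pos[of v0 "d w v0"] by simp
  qed
  have "\<phi> v0 = 1" using e[of 0, OF _ nz(1)] nz(2) by simp
  then show ?thesis
    by (rule spherical_functionI[OF v0 r _ e]) simp_all
qed

end

theorem lemma3p2:
  fixes adj :: "'v \<Rightarrow> 'v \<Rightarrow> bool" and Vp Vm :: "'v set" and qp qm :: nat
    and v0 :: 'v and \<tau> :: "'v \<Rightarrow> 'v \<Rightarrow> 'v" and \<phi> :: "'v \<Rightarrow> complex"
  assumes "qp > 1" and "qm > 1" and "qp \<noteq> qm"
    and "semihomogeneous_tree adj Vp Vm qp qm"
    and "v0 \<in> Vp"
    and "\<forall>v\<in>Vp. \<tau> v \<in> graph_aut adj \<and> \<tau> v v0 = v"
    and "\<exists>v\<in>Vp. \<phi> v \<noteq> 0"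
  shows "(spherical_function adj Vp qp qm v0 \<phi> \<longleftrightarrow>
            (\<forall>v\<in>Vp. \<forall>w\<in>Vp. radialize adj v0 (translate (\<tau> v) \<phi>) w = \<phi> v * \<phi> w))
       \<and> (radial_on adj v0 Vp \<phi> \<longrightarrow>
            (spherical_function adj Vp qp qm v0 \<phi> \<longleftrightarrow> multiplicative_functional adj Vp v0 \<phi>))"
proof -
  interpret rooted_tree adj Vp Vm qp qm v0 \<tau>
    using assms by unfold_locales auto
  show ?thesis
    using spherical_iff_functional_equation[of v0 \<tau> \<phi>] v0 \<tau> assms(7)
      spherical_imp_multiplicative multiplicative_imp_spherical by blast
qed

end
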